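(* In addition to the standing assumptions listed in the context, assume (H2): there exist constants $\theta_1\in(0,1)$ and $\theta_2$ such that $\min_{u\in\mathcal{U}(x)}c(x,u)\ge\theta_1V_\star(x)-\theta_2$ for all $x\in\mathbb{X}$. Suppose that $\Phi_0\in\mathcal{L}(\mathbb{X})\cap\mathcal{O}(V_\star)$, and let $\{\Phi_n\}$ be the value iteration sequence $\Phi_{n+1}(x)=\min_{u\in\mathcal{U}(x)}[c(x,u)-\beta+\int\Phi_n(y)P(dy\,|\,x,u)]$, $n\ge0$. Then there exists a constant $\widehat C_0$ depending on $\Phi_0$ such that $$|\Phi_n(x)-V_\star(x)|\le\widehat C_0\bigl(1+(1-\theta_1)^nV_\star(x)\bigr)\qquad\text{for all }x\in\mathbb{X},\ n\in\mathbb{N}.$$ In addition, $\Phi_n(x)-V_\star(x)$ converges to a constant $\pi_\star$-a.e. as $n\to\infty$.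
   Context: Notation. For a Polish space $\mathbb{Y}$, $\mathfrak{B}(\mathbb{Y})$ is its Borel $\sigma$-algebra, $\mathfrak{P}(\mathbb{Y})$ the Borel probability measures, $\mathcal{M}(\mathbb{Y})$ the real-valued Borel functions, $\mathcal{M}_b(\mathbb{Y})$ the bounded ones, $C_b(\mathbb{Y})$ the bounded continuous functions, and $\mathcal{L}(\mathbb{Y})$ the real-valued lower semicontinuous functions bounded from below. For $f\in\mathcal{M}(\mathbb{X})$, $\|g\|_f=\sup_x\frac{|g(x)|}{1+|f(x)|}$ and $\mathcal{O}(f)=\{g\in\mathcal{M}(\mathbb{X}):\|g\|_f<\infty\}$. Model. A Markov decision process $(\mathbb{X},\mathbb{U},\mathcal{U},P,c)$: the state space $\mathbb{X}$ and the action space $\mathbb{U}$ are Polish; $\mathcal{U}:\mathbb{X}\to\mathfrak{B}(\mathbb{U})$ is a strict (nonempty-valued) measurable multifunction; $\mathbb{K}=\{(x,u):x\in\mathbb{X},\,u\in\mathcal{U}(x)\}$ has the relative topology of $\mathbb{X}\times\mathbb{U}$; $P(\cdot\,|\,x,u)$ is a stochastic kernel on $\mathbb{K}\times\mathfrak{B}(\mathbb{X})$; $c:\mathbb{K}\to[1,\infty]$ is the measurable running cost. Admissible strategies $\xi=\{\xi_t\}\in\mathfrak{U}$ are sequences of stochastic kernels on $\mathbb{U}$ given the history $h_t=(x_0,u_0,\dots,u_{t-1},x_t)$ with $\xi_t(\mathcal{U}(x_t)\,|\,h_t)=1$; $\mathbb{P}^\xi_\mu$, $\mathbb{E}^\xi_\mu$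 are the induced law and expectation of $(X_t,U_t)_{t\ge0}$ with $X_0\sim\mu$ (subscript $x$ for the Dirac mass at $x$). $\mathfrak{U}_{\mathrm{sm}}$ is the set of stationary Markov randomized strategies, i.e. stochastic kernels $v(du\,|\,x)$ with $v(\mathcal{U}(x)\,|\,x)=1$ (a measurable selector $v:\mathbb{X}\to\mathbb{U}$ of $\mathcal{U}$ is identified with the kernel of Dirac masses). For $v\in\mathfrak{U}_{\mathrm{sm}}$, $P_v(A\,|\,x)=\int P(A\,|\,x,u)v(du\,|\,x)$ and $c_v(x)=\int c(x,u)v(du\,|\,x)$. Average cost. $\mathcal{E}(\mu,\xi)=\limsup_{N}\frac1N\mathbb{E}^\xi_\mu[\sum_{n=0}^{N-1}c(X_n,U_n)]$, $J(\mu)=\inf_{\xi\in\mathfrak{U}}\mathcal{E}(\mu,\xi)$ ($J(x)$ for the Dirac mass at $x$), $\beta=\inf_{\mu}J(\mu)$. A strategy $\xi$ is optimal if $\mathcal{E}(\mu,\xi)=J(\mu)$ for all $\mu\in\mathfrak{P}(\mathbb{X})$. Standing assumptions. Basic: $P$ is strongly continuous, i.e. $(x,u)\mapsto\int f(y)P(dy\,|\,x,u)$ is continuous on $\mathbb{K}$ for every $f\in\mathcal{M}_b(\mathbb{X})$; $\mathcal{U}$ is upper semicontinuous and closed-valued; $c$ is lower semicontinuous. (A0): there are a bounded (Borel) set $\mathcal{B}\subset\mathbb{X}$ with $\inf_{(x,u)\in(\mathcal{B}^c\times\mathbb{U})\cap\mathbb{K}}c(x,u)>\beta$, a measure $\nu\in\mathfrak{P}(\mathbb{X})$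 with $\nu(\mathcal{B})=1$ and a constant $\delta>0$ with $P(A\,|\,x,u)\ge\delta\nu(A)\mathbf{1}_{\mathcal{B}}(x)$ for all $A\in\mathfrak{B}(\mathbb{X})$, $(x,u)\in\mathbb{K}$, and $\sum_{n\ge1}\mathbb{P}^v_x(X_n\in\mathcal{B})>0$ for all $v\in\mathfrak{U}_{\mathrm{sm}}$, $x\in\mathbb{X}$. Here $\delta$ is chosen so that $\inf_{(x,u)\in(\mathcal{B}\times\mathbb{U})\cap\mathbb{K}}P(\mathcal{B}\,|\,x,u)>\delta$. (A1): either (i) $J(x)<\infty$ for some $x$ and $c$ is inf-compact on $\mathbb{K}$ (all sets $\{c\le\kappa\}$, $\kappa\in\mathbb{R}$, are compact); or (ii) $c$ is $\mathcal{K}$-inf-compact (inf-compact on $(K\times\mathbb{U})\cap\mathbb{K}$ for each compact $K\subset\mathbb{X}$) and (C) holds. Condition (C): there is a continuous one-one embedding of $\mathbb{K}$ into a Polish space whose image has compact closure $\mathbb{K}^*$ ($\mathbb{K}$ being identified with its image), where $\mathbb{K}^*$ is taken to be the closure of $\mathbb{K}$ in $\mathbb{X}^*\times\mathbb{U}^*$ with $\mathbb{X}^*,\mathbb{U}^*$ compact dense embeddings of $\mathbb{X},\mathbb{U}$ into suitable Polish spaces, assumed to exist; and there are a compact $\widetilde K\subset\mathbb{K}$ and $\varepsilon_0>0$ with $c\ge\beta+\varepsilon_0$ on $\mathbb{K}\setminus\widetilde K$. (A2): there exists a $c$-stable $v\in\mathfrak{U}_{\mathrm{sm}}$ (defined below).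 Split chain. Let $\mathcal{X}=(\mathbb{X}\times\{0\})\cup(\mathcal{B}\times\{1\})$. For $\mu\in\mathfrak{P}(\mathbb{X})$ (and by linearity for finite measures) define $\breve\mu$ on $\mathcal{X}$ by $\breve\mu(A\times\{0\})=(1-\delta)\mu(A\cap\mathcal{B})+\mu(A\cap\mathcal{B}^c)$, $A\in\mathfrak{B}(\mathbb{X})$, and $\breve\mu(A\times\{1\})=\delta\mu(A)$, $A\in\mathfrak{B}(\mathcal{B})$; $\breve P(\cdot\,|\,x,u)$ is obtained from $P(\cdot\,|\,x,u)$ in this way. The split chain $\breve X_n=(X_n,i_n)$ on $\mathcal{X}$ has kernel $Q(\cdot\,|\,(x,i),u)$ equal to $\breve P(\cdot\,|\,x,u)$ if $i=0$, $x\notin\mathcal{B}$; to $\frac{1}{1-\delta}(\breve P(\cdot\,|\,x,u)-\delta\breve\nu)$ if $i=0$, $x\in\mathcal{B}$; and to $\breve\nu$ if $i=1$, $x\in\mathcal{B}$. Its cost is $\breve c((x,0),u)=c(x,u)$ for $x\in\mathcal{B}^c$, $\breve c((x,0),u)=\frac{c(x,u)}{1-\delta}$ for $x\in\mathcal{B}$, and $\breve c((x,1),u)=0$. A $v\in\mathfrak{U}_{\mathrm{sm}}$ controls the split chain by applying $v(\cdot\,|\,x)$ at $(x,i)$; $\breve c_v(x,i)=\int\breve c((x,i),u)v(du\,|\,x)$ and $\breve{\mathbb{E}}^v_{(x,i)}$ is the expectation started at $(x,i)$. Let $\breve\tau=\min\{n\ge1:\breve X_n\in\mathcal{B}\times\{1\}\}$.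 A $v\in\mathfrak{U}_{\mathrm{sm}}$ is $c$-stable if $x\mapsto\breve{\mathbb{E}}^v_{(x,0)}[\sum_{k=0}^{\breve\tau-1}\breve c_v(\breve X_k)]$ is bounded on every bounded subset of $\mathbb{X}$. Definition of $V_\star$. $\breve V^{(0)}_\star(x)=\inf_{v\in\mathfrak{U}_{\mathrm{sm}}}\breve{\mathbb{E}}^v_{(x,0)}\bigl[\sum_{k=0}^{\breve\tau-1}(\breve c_v(\breve X_k)-\beta)\bigr]$, and $V_\star(x)=(1-\delta)\breve V^{(0)}_\star(x)$ for $x\in\mathcal{B}$, $V_\star(x)=\breve V^{(0)}_\star(x)$ for $x\notin\mathcal{B}$. The function $V_\star\in\mathcal{L}(\mathbb{X})$ solves $V_\star(x)=\min_{u\in\mathcal{U}(x)}[c(x,u)-\beta+\int V_\star(y)P(dy\,|\,x,u)]$. Fixed optimal strategy. $v_\star$ is a fixed optimal stationary Markov strategy which is a measurable selector of the minimizer in this equation, so $V_\star=c_{v_\star}-\beta+P_{v_\star}V_\star$ on $\mathbb{X}$; $\pi_\star$ is the invariant probability measure of the chain controlled by $v_\star$.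
   Formalization: The bound is proved with |V_⋆(x)| in place of V_⋆(x): V_⋆ is only bounded below and may be less than −1, in which case the printed right-hand side can be negative and the printed bound fails (e.g. at n = 0); where V_⋆ ≥ 0 the two bounds coincide. *)

theory Defs
  imports "HOL-Probability.Probability"
begin

section \<open>Function classes\<close>

definition lsc_on :: "'a::topological_space set \<Rightarrow> ('a \<Rightarrow> 'b::linorder) \<Rightarrow> bool" where
  "lsc_on S f \<longleftrightarrow> (\<forall>a. openin (top_of_set S) {z \<in> S. a < f z})"

definition lsc_bounded_below :: "('a::topological_space \<Rightarrow> real) set" where
  "lsc_bounded_below = {f. lsc_on UNIV f \<and> bdd_below (range f)}"

definition weighted_norm :: "('a \<Rightarrow> real) \<Rightarrow> ('a \<Rightarrow> real) \<Rightarrow> ereal" where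
  "weighted_norm f g = (SUP x. ereal (\<bar>g x\<bar> / (1 + \<bar>f x\<bar>)))"

definition O_class :: "('a::topological_space \<Rightarrow> real) \<Rightarrow> ('a \<Rightarrow> real) set" where
  "O_class f = {g \<in> borel_measurable borel. weighted_norm f g < \<infinity>}"

text \<open>The integral of an extended real function as the difference of the integrals of its positive
  and negative parts. It is used only where the negative part has a finite integral.\<close>

definition eintegral :: "'a measure \<Rightarrow> ('a \<Rightarrow> ereal) \<Rightarrow> ereal" where
  "eintegral N f =
     enn2ereal (\<integral>\<^sup>+ y. e2ennreal (f y) \<partial>N) - enn2ereal (\<integral>\<^sup>+ y. e2ennreal (- f y) \<partial>N)"

definition attains_min :: "('a \<Rightarrow> 'b::linorder) \<Rightarrow> 'a set \<Rightarrow> 'b \<Rightarrow> bool" where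
  "attains_min f S m \<longleftrightarrow> (\<exists>u. is_arg_min f (\<lambda>w. w \<in> S) u \<and> f u = m)"

section \<open>Laws of processes\<close>

text \<open>The law on sequences (Ionescu-Tulcea) of the process whose coordinate \<open>n\<close> has conditional
  distribution \<open>k n \<omega>\<close> given the coordinates \<open>\<omega>\<close> with index below \<open>n\<close>.\<close>

definition process_law :: "'s measure \<Rightarrow> (nat \<Rightarrow> (nat \<Rightarrow> 's) \<Rightarrow> 's measure) \<Rightarrow> (nat \<Rightarrow> 's) measure" where
  "process_law S k =
     projective_family.lim UNIV (Ionescu_Tulcea.CI k (\<lambda>_. S)) (\<lambda>_. S)"

definition markov_law :: "'s measure \<Rightarrow> 's measure \<Rightarrow> ('s \<Rightarrow> 's measure) \<Rightarrow> (nat \<Rightarrow> 's) measure" where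
  "markov_law S \<mu> R = process_law S (\<lambda>n \<omega>. case n of 0 \<Rightarrow> \<mu> | Suc m \<Rightarrow> R (\<omega> m))"

section \<open>Markov decision processes\<close>

record ('x, 'u) mdp =
  actions :: "'x \<Rightarrow> 'u set"
  kernel :: "'x \<times> 'u \<Rightarrow> 'x measure"
  cost :: "'x \<times> 'u \<Rightarrow> ennreal"

definition KK :: "('x, 'u) mdp \<Rightarrow> ('x \<times> 'u) set" where
  "KK M = {(x, u). u \<in> actions M x}"

definition is_mdp :: "('x::polish_space, 'u::polish_space) mdp \<Rightarrow> bool" where
  "is_mdp M \<longleftrightarrow>
     (\<forall>x. actions M x \<in> sets borel \<and> actions M x \<noteq> {}) \<and>
     (\<forall>F. closed F \<longrightarrow> {x. actions M x \<inter> F \<noteq> {}} \<in> sets borel) \<and>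
     kernel M \<in> restrict_space borel (KK M) \<rightarrow>\<^sub>M prob_algebra borel \<and>
     cost M \<in> borel_measurable (restrict_space borel (KK M)) \<and>
     (\<forall>z\<in>KK M. 1 \<le> cost M z)"

text \<open>The kernel is given on \<open>KK M\<close> only. Outside this set, which the controlled process does not
  visit, it is completed by Dirac masses so that the library's constructions apply.\<close>

definition kernel_ext :: "('x::polish_space, 'u::polish_space) mdp \<Rightarrow> 'x \<times> 'u \<Rightarrow> 'x measure" where
  "kernel_ext M z = (if z \<in> KK M then kernel M z else return borel (fst z))"

text \<open>In a strategy \<open>\<xi>\<close>, the kernel \<open>\<xi> t\<close> takes the history \<open>h\<^sub>t\<close> in the form of the state-action
  pairs with index below \<open>t\<close> together with the current state.\<close>

type_synonym ('x, 'u) strategy = "nat \<Rightarrow> (nat \<Rightarrow> 'x \<times> 'u) \<times> 'x \<Rightarrow> 'u measure"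

definition admissible :: "('x::polish_space, 'u::polish_space) mdp \<Rightarrow> ('x, 'u) strategy set" where
  "admissible M = {\<xi>. \<forall>t.
     \<xi> t \<in> (PiM {0..<t} (\<lambda>_. borel) \<Otimes>\<^sub>M borel) \<rightarrow>\<^sub>M prob_algebra borel \<and>
     (\<forall>h \<in> space (PiM {0..<t} (\<lambda>_. borel :: ('x \<times> 'u) measure)). \<forall>x.
        emeasure (\<xi> t (h, x)) (actions M x) = 1)}"

definition controlled_law ::
    "('x::polish_space, 'u::polish_space) mdp \<Rightarrow> 'x measure \<Rightarrow> ('x, 'u) strategy \<Rightarrow> (nat \<Rightarrow> 'x \<times> 'u) measure" where
  "controlled_law M \<mu> \<xi> = process_law borel (\<lambda>n \<omega>.
     (case n of 0 \<Rightarrow> \<mu> | Suc m \<Rightarrow> kernel_ext M (\<omega> m)) \<bind>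
       (\<lambda>x. distr (\<xi> n (\<omega>, x)) borel (\<lambda>u. (x, u))))"

definition stationary_strategies ::
    "('x::polish_space, 'u::polish_space) mdp \<Rightarrow> ('x \<Rightarrow> 'u measure) set" where
  "stationary_strategies M =
     {v \<in> borel \<rightarrow>\<^sub>M prob_algebra borel. \<forall>x. emeasure (v x) (actions M x) = 1}"

definition as_strategy :: "('x \<Rightarrow> 'u measure) \<Rightarrow> ('x, 'u) strategy" where
  "as_strategy v = (\<lambda>t (h, x). v x)"

definition dirac_strategy :: "('x \<Rightarrow> 'u::topological_space) \<Rightarrow> 'x \<Rightarrow> 'u measure" where
  "dirac_strategy s = (\<lambda>x. return borel (s x))"

definition measurable_selector ::
    "('x::polish_space, 'u::polish_space) mdp \<Rightarrow> ('x \<Rightarrow> 'u) \<Rightarrow> bool" where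
  "measurable_selector M s \<longleftrightarrow> s \<in> borel_measurable borel \<and> (\<forall>x. s x \<in> actions M x)"

definition kernel_under ::
    "('x::polish_space, 'u::polish_space) mdp \<Rightarrow> ('x \<Rightarrow> 'u measure) \<Rightarrow> 'x \<Rightarrow> 'x measure" where
  "kernel_under M v x = v x \<bind> (\<lambda>u. kernel_ext M (x, u))"

definition invariant_prob ::
    "('x::polish_space, 'u::polish_space) mdp \<Rightarrow> ('x \<Rightarrow> 'u measure) \<Rightarrow> 'x measure \<Rightarrow> bool" where
  "invariant_prob M v \<pi> \<longleftrightarrow> \<pi> \<in> space (prob_algebra borel) \<and> \<pi> \<bind> kernel_under M v = \<pi>"

subsection \<open>Average cost\<close>

definition avg_cost ::
    "('x::polish_space, 'u::polish_space) mdp \<Rightarrow> 'x measure \<Rightarrow> ('x, 'u) strategy \<Rightarrow> ennreal" where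
  "avg_cost M \<mu> \<xi> =
     limsup (\<lambda>N. (\<integral>\<^sup>+ \<omega>. (\<Sum>n<N. cost M (\<omega> n)) \<partial>controlled_law M \<mu> \<xi>) / of_nat N)"

definition optimal_cost :: "('x::polish_space, 'u::polish_space) mdp \<Rightarrow> 'x measure \<Rightarrow> ennreal" where
  "optimal_cost M \<mu> = (INF \<xi> \<in> admissible M. avg_cost M \<mu> \<xi>)"

definition beta :: "('x::polish_space, 'u::polish_space) mdp \<Rightarrow> ennreal" where
  "beta M = (INF \<mu> \<in> space (prob_algebra borel). optimal_cost M \<mu>)"

definition optimal :: "('x::polish_space, 'u::polish_space) mdp \<Rightarrow> ('x, 'u) strategy \<Rightarrow> bool" where
  "optimal M \<xi> \<longleftrightarrow> \<xi> \<in> admissible M \<and>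
     (\<forall>\<mu> \<in> space (prob_algebra borel). avg_cost M \<mu> \<xi> = optimal_cost M \<mu>)"

text \<open>The cost being at least 1, the expression inside the minimum has no indeterminate form
  when \<open>f\<close> is bounded below. \<open>beta M\<close> is finite under \<open>A0\<close>.\<close>

definition bellman ::
    "('x::polish_space, 'u::polish_space) mdp \<Rightarrow> ('x \<Rightarrow> real) \<Rightarrow> 'x \<Rightarrow> 'u \<Rightarrow> ereal" where
  "bellman M f x u = enn2ereal (cost M (x, u)) - enn2ereal (beta M)
     + eintegral (kernel M (x, u)) (\<lambda>y. ereal (f y))"

definition value_iteration ::
    "('x::polish_space, 'u::polish_space) mdp \<Rightarrow> (nat \<Rightarrow> 'x \<Rightarrow> real) \<Rightarrow> bool" where
  "value_iteration M \<Phi> \<longleftrightarrow>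
     (\<forall>n x. attains_min (bellman M (\<Phi> n) x) (actions M x) (ereal (\<Phi> (Suc n) x)))"

subsection \<open>Standing assumptions other than stability\<close>

definition basic_assumption :: "('x::polish_space, 'u::polish_space) mdp \<Rightarrow> bool" where
  "basic_assumption M \<longleftrightarrow>
     (\<forall>f \<in> borel_measurable borel. bounded (range f) \<longrightarrow>
        continuous_on (KK M) (\<lambda>z. \<integral>y. (f y :: real) \<partial>kernel M z)) \<and>
     (\<forall>F. closed F \<longrightarrow> closed {x. actions M x \<inter> F \<noteq> {}}) \<and>
     (\<forall>x. closed (actions M x)) \<and>
     lsc_on (KK M) (cost M)"

definition A0 ::
    "('x::polish_space, 'u::polish_space) mdp \<Rightarrow> 'x set \<Rightarrow> 'x measure \<Rightarrow> real \<Rightarrow> bool" where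
  "A0 M B \<nu> \<delta> \<longleftrightarrow>
     B \<in> sets borel \<and> bounded B \<and>
     beta M < (INF z \<in> ((- B) \<times> UNIV) \<inter> KK M. cost M z) \<and>
     \<nu> \<in> space (prob_algebra borel) \<and> emeasure \<nu> B = 1 \<and>
     0 < \<delta> \<and>
     (\<forall>A \<in> sets borel. \<forall>(x, u) \<in> KK M.
        ennreal \<delta> * emeasure \<nu> A * indicator B x \<le> emeasure (kernel M (x, u)) A) \<and>
     (\<forall>v \<in> stationary_strategies M. \<forall>x.
        0 < (\<Sum>n. emeasure (controlled_law M (return borel x) (as_strategy v))
                    {\<omega> \<in> space (PiM UNIV (\<lambda>_. borel)). fst (\<omega> (Suc n)) \<in> B})) \<and>
     ennreal \<delta> < (INF z \<in> (B \<times> UNIV) \<inter> KK M. emeasure (kernel M z) B)"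

definition inf_compact :: "('x::polish_space, 'u::polish_space) mdp \<Rightarrow> bool" where
  "inf_compact M \<longleftrightarrow> (\<forall>\<kappa>::real. compact {z \<in> KK M. cost M z \<le> ennreal \<kappa>})"

definition K_inf_compact :: "('x::polish_space, 'u::polish_space) mdp \<Rightarrow> bool" where
  "K_inf_compact M \<longleftrightarrow> (\<forall>K. compact K \<longrightarrow>
     (\<forall>\<kappa>::real. compact {z \<in> (K \<times> UNIV) \<inter> KK M. cost M z \<le> ennreal \<kappa>}))"

text \<open>The Polish spaces in which the state and action spaces are embedded are the types
  \<open>'a\<close> and \<open>'b\<close>; the compact spaces \<open>X\<^sup>*\<close>, \<open>U\<^sup>*\<close> and \<open>K\<^sup>*\<close> are the closures of the images.\<close>

definition condition_C ::
    "('x::polish_space, 'u::polish_space) mdp \<Rightarrow> 'a::polish_space itself \<Rightarrow> 'b::polish_space itself \<Rightarrow> bool" where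
  "condition_C M TA TB \<longleftrightarrow>
     (\<exists>(i :: 'x \<Rightarrow> 'a) (j :: 'u \<Rightarrow> 'b).
        continuous_on UNIV i \<and> inj i \<and> compact (closure (range i)) \<and>
        continuous_on UNIV j \<and> inj j \<and> compact (closure (range j)) \<and>
        compact (closure (map_prod i j ` KK M))) \<and>
     (\<exists>Kt \<epsilon>. Kt \<subseteq> KK M \<and> compact Kt \<and> 0 < \<epsilon> \<and>
        (\<forall>z \<in> KK M - Kt. beta M + ennreal \<epsilon> \<le> cost M z))"

definition A1 ::
    "('x::polish_space, 'u::polish_space) mdp \<Rightarrow> 'a::polish_space itself \<Rightarrow> 'b::polish_space itself \<Rightarrow> bool" where
  "A1 M TA TB \<longleftrightarrow>
     ((\<exists>x. optimal_cost M (return borel x) < \<infinity>) \<and> inf_compact M) \<or>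
     (K_inf_compact M \<and> condition_C M TA TB)"

section \<open>Split chain\<close>

text \<open>\<open>(x, False)\<close> and \<open>(x, True)\<close> stand for \<open>(x, 0)\<close> and \<open>(x, 1)\<close>. The points \<open>(x, True)\<close> with
  \<open>x \<notin> B\<close> do not belong to the state space of the split chain; every split measure gives them mass
  0, so the values of the kernel and of the cost there play no role.\<close>

abbreviation split_space :: "('x::polish_space \<times> bool) measure" where
  "split_space \<equiv> borel \<Otimes>\<^sub>M count_space UNIV"

definition split_measure ::
    "'x::polish_space set \<Rightarrow> real \<Rightarrow> 'x measure \<Rightarrow> ('x \<times> bool) measure" where
  "split_measure B \<delta> \<mu> = measure_of (space split_space) (sets split_space) (\<lambda>S.
     ennreal (1 - \<delta>) * emeasure \<mu> ({x. (x, False) \<in> S} \<inter> B)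
     + emeasure \<mu> ({x. (x, False) \<in> S} \<inter> - B)
     + ennreal \<delta> * emeasure \<mu> ({x. (x, True) \<in> S} \<inter> B))"

definition split_kernel ::
    "('x::polish_space, 'u::polish_space) mdp \<Rightarrow> 'x set \<Rightarrow> 'x measure \<Rightarrow> real \<Rightarrow> 'x \<times> bool \<Rightarrow> 'u \<Rightarrow> ('x \<times> bool) measure" where
  "split_kernel M B \<nu> \<delta> = (\<lambda>(x, i) u.
     if i then split_measure B \<delta> \<nu>
     else if x \<in> B then
       measure_of (space split_space) (sets split_space) (\<lambda>S.
         (emeasure (split_measure B \<delta> (kernel M (x, u))) S
          - ennreal \<delta> * emeasure (split_measure B \<delta> \<nu>) S) / ennreal (1 - \<delta>))
     else split_measure B \<delta> (kernel M (x, u)))"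

text \<open>Completion by Dirac masses for actions that are not available, as in \<open>kernel_ext\<close>.\<close>

definition split_kernel_under ::
    "('x::polish_space, 'u::polish_space) mdp \<Rightarrow> 'x set \<Rightarrow> 'x measure \<Rightarrow> real \<Rightarrow> ('x \<Rightarrow> 'u measure) \<Rightarrow>
       'x \<times> bool \<Rightarrow> ('x \<times> bool) measure" where
  "split_kernel_under M B \<nu> \<delta> v z = v (fst z) \<bind>
     (\<lambda>u. if u \<in> actions M (fst z) then split_kernel M B \<nu> \<delta> z u else return split_space z)"

definition split_cost ::
    "('x::polish_space, 'u::polish_space) mdp \<Rightarrow> 'x set \<Rightarrow> real \<Rightarrow> 'x \<times> bool \<Rightarrow> 'u \<Rightarrow> ennreal" where
  "split_cost M B \<delta> = (\<lambda>(x, i) u.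
     if i then 0 else if x \<in> B then cost M (x, u) / ennreal (1 - \<delta>) else cost M (x, u))"

definition split_cost_under ::
    "('x::polish_space, 'u::polish_space) mdp \<Rightarrow> 'x set \<Rightarrow> real \<Rightarrow> ('x \<Rightarrow> 'u measure) \<Rightarrow> 'x \<times> bool \<Rightarrow> ennreal" where
  "split_cost_under M B \<delta> v z = (\<integral>\<^sup>+ u \<in> actions M (fst z). split_cost M B \<delta> z u \<partial>v (fst z))"

definition split_law ::
    "('x::polish_space, 'u::polish_space) mdp \<Rightarrow> 'x set \<Rightarrow> 'x measure \<Rightarrow> real \<Rightarrow> ('x \<Rightarrow> 'u measure) \<Rightarrow>
       'x \<times> bool \<Rightarrow> (nat \<Rightarrow> 'x \<times> bool) measure" where
  "split_law M B \<nu> \<delta> v z =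
     markov_law split_space (return split_space z) (split_kernel_under M B \<nu> \<delta> v)"

definition split_tau :: "'x set \<Rightarrow> (nat \<Rightarrow> 'x \<times> bool) \<Rightarrow> enat" where
  "split_tau B \<omega> = Inf {enat n |n. 1 \<le> n \<and> \<omega> n \<in> B \<times> {True}}"

definition c_stable ::
    "('x::polish_space, 'u::polish_space) mdp \<Rightarrow> 'x set \<Rightarrow> 'x measure \<Rightarrow> real \<Rightarrow> ('x \<Rightarrow> 'u measure) \<Rightarrow> bool" where
  "c_stable M B \<nu> \<delta> v \<longleftrightarrow> (\<forall>D. bounded D \<longrightarrow> (\<exists>C::real. \<forall>x\<in>D.
     (\<integral>\<^sup>+ \<omega>. (\<Sum>k. if enat k < split_tau B \<omega> then split_cost_under M B \<delta> v (\<omega> k) else 0)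
        \<partial>split_law M B \<nu> \<delta> v (x, False)) \<le> ennreal C))"

definition A2 ::
    "('x::polish_space, 'u::polish_space) mdp \<Rightarrow> 'x set \<Rightarrow> 'x measure \<Rightarrow> real \<Rightarrow> bool" where
  "A2 M B \<nu> \<delta> \<longleftrightarrow> (\<exists>v \<in> stationary_strategies M. c_stable M B \<nu> \<delta> v)"

text \<open>Negative terms of the sum occur only while the chain is in \<open>B\<close>, and the number of such
  visits before \<open>split_tau\<close> is dominated by a geometric variable under \<open>A0\<close>; hence the series
  converges almost surely and its negative part is integrable.\<close>

definition Vstar_split ::
    "('x::polish_space, 'u::polish_space) mdp \<Rightarrow> 'x set \<Rightarrow> 'x measure \<Rightarrow> real \<Rightarrow> 'x \<Rightarrow> ereal" where
  "Vstar_split M B \<nu> \<delta> x = (INF v \<in> stationary_strategies M.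
     eintegral (split_law M B \<nu> \<delta> v (x, False)) (\<lambda>\<omega>.
       \<Sum>k. if enat k < split_tau B \<omega>
           then enn2ereal (split_cost_under M B \<delta> v (\<omega> k)) - enn2ereal (beta M) else 0))"

definition Vstar_ext ::
    "('x::polish_space, 'u::polish_space) mdp \<Rightarrow> 'x set \<Rightarrow> 'x measure \<Rightarrow> real \<Rightarrow> 'x \<Rightarrow> ereal" where
  "Vstar_ext M B \<nu> \<delta> x =
     (if x \<in> B then ereal (1 - \<delta>) * Vstar_split M B \<nu> \<delta> x else Vstar_split M B \<nu> \<delta> x)"

text \<open>\<open>V\<close> is the real-valued function \<open>V\<^sub>\<star>\<close>, together with the properties it comes with: it belongs to
  \<open>lsc_bounded_below\<close> and solves the average cost optimality equation.\<close>

definition is_Vstar ::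
    "('x::polish_space, 'u::polish_space) mdp \<Rightarrow> 'x set \<Rightarrow> 'x measure \<Rightarrow> real \<Rightarrow> ('x \<Rightarrow> real) \<Rightarrow> bool" where
  "is_Vstar M B \<nu> \<delta> V \<longleftrightarrow>
     (\<forall>x. ereal (V x) = Vstar_ext M B \<nu> \<delta> x) \<and>
     V \<in> lsc_bounded_below \<and>
     (\<forall>x. attains_min (bellman M V x) (actions M x) (ereal (V x)))"

definition H2 ::
    "('x::polish_space, 'u::polish_space) mdp \<Rightarrow> ('x \<Rightarrow> real) \<Rightarrow> real \<Rightarrow> real \<Rightarrow> bool" where
  "H2 M V \<theta>\<^sub>1 \<theta>\<^sub>2 \<longleftrightarrow> 0 < \<theta>\<^sub>1 \<and> \<theta>\<^sub>1 < 1 \<and>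
     (\<forall>x. ereal (\<theta>\<^sub>1 * V x - \<theta>\<^sub>2) \<le> (INF u \<in> actions M x. enn2ereal (cost M (x, u))))"

end

theory Submission
  imports Defs
begin

text \<open>Put \<open>f n = \<Phi> n - V\<close>, let \<open>T\<close> be the transition operator under \<open>v_star\<close> and \<open>W = V + const \<ge> 1\<close>.
  Minimality of \<open>\<Phi> (n + 1)\<close> gives \<open>f (n + 1) \<le> T (f n)\<close>, and H2 together with the optimality equation
  gives \<open>T W \<le> (1 - \<theta>\<^sub>1) W + const\<close>; iterating both yields the upper bound, while the lower bound follows
  by induction from \<open>c \<ge> \<theta>\<^sub>1 V - const\<close> for every action. For the convergence, the optimality equation
  says \<open>T W \<le> W - \<epsilon>\<close> off \<open>B\<close>, which combines with the previous inequality into a geometric drift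
  \<open>T W \<le> \<rho> W + K 1\<^sub>B\<close>. Since \<open>B\<close> satisfies a one-step minorization with \<open>\<nu>(B) = 1\<close>, the sublevel sets of \<open>W\<close>
  are small for some power of \<open>T\<close>, and that power contracts a weighted oscillation seminorm (the argument
  of Hairer and Mattingly for Harris' theorem). The nonnegative defects \<open>T (f n) - f (n + 1)\<close> have a
  finite total \<open>\<pi>_star\<close>-mass, and with geometric ergodicity this forces \<open>f n\<close> to converge almost everywhere.\<close>

section \<open>Weighted geometric ergodicity\<close>

text \<open>A Foster-Lyapunov drift toward \<open>B\<close>. With \<open>1 \<le> W\<close>,
  constants count as functions of growth \<open>W\<close>; \<open>0 < K\<close> lets
  \<open>sublevel_small\<close> divide by \<open>K\<close>.\<close>

locale weighted_kernel =
  fixes P :: "'a::topological_space \<Rightarrow> 'a measure" and W :: "'a \<Rightarrow> real"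
    and B :: "'a set" and \<rho> K :: real
  assumes kernel: "P \<in> borel \<rightarrow>\<^sub>M prob_algebra borel"
    and weight_measurable [measurable]: "W \<in> borel_measurable borel"
    and weight_ge_1: "1 \<le> W x"
    and weight_integrable: "integrable (P x) W"
    and drift: "(\<integral>y. W y \<partial>P x) \<le> \<rho> * W x + K * indicator B x"
    and rate: "0 < \<rho>" "\<rho> < 1"
    and const_pos: "0 < K"
    and sets_B [measurable]: "B \<in> sets borel"
begin

section \<open>Transition operator on functions of growth \<open>W\<close>\<close>

definition T :: "('a \<Rightarrow> real) \<Rightarrow> 'a \<Rightarrow> real" where
  "T g x = (\<integral>y. g y \<partial>P x)"

text \<open>A ball of the weighted sup norm with an explicit radius, so that estimates can track
  \<open>c\<close>; it need not be the smallest radius.\<close>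

definition wbdd :: "real \<Rightarrow> ('a \<Rightarrow> real) \<Rightarrow> bool" where
  "wbdd c g \<longleftrightarrow> g \<in> borel_measurable borel \<and> (\<forall>x. \<bar>g x\<bar> \<le> c * W x)"

lemma kernel_prob: "prob_space (P x)" and kernel_sets [measurable_cong]: "sets (P x) = sets borel"
  using measurable_space[OF kernel, of x] by (auto simp: space_prob_algebra)

lemma kernel_subprob [measurable]: "P \<in> borel \<rightarrow>\<^sub>M subprob_algebra borel"
  by (rule measurable_prob_algebraD[OF kernel])

lemma kernel_space [simp]: "space (P x) = UNIV"
  using sets_eq_imp_space_eq[OF kernel_sets[of x]] by simp

lemma weight_pos: "0 < W x" and weight_nonneg: "0 \<le> W x"
  using weight_ge_1[of x] by auto

lemma wbdd_measurable: "wbdd c g \<Longrightarrow> g \<in> borel_measurable borel"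
  by (simp add: wbdd_def)

lemma wbdd_abs: "wbdd c g \<Longrightarrow> \<bar>g x\<bar> \<le> c * W x"
  by (simp add: wbdd_def)

lemma wbdd_nonneg: "wbdd c g \<Longrightarrow> 0 \<le> c"
  using wbdd_abs[of c g undefined] weight_pos[of undefined]
  by (smt (verit) mult_neg_pos)

lemma wbdd_weight: "wbdd 1 W"
  using weight_nonneg by (simp add: wbdd_def)

lemma wbdd_const: "wbdd \<bar>c\<bar> (\<lambda>x. c)"
  using weight_ge_1 mult_left_mono[of 1 "W _" "\<bar>c\<bar>"] by (auto simp: wbdd_def)

lemma wbdd_indicator: "A \<in> sets borel \<Longrightarrow> wbdd 1 (indicator A)"
  using weight_ge_1 weight_nonneg by (auto simp: wbdd_def indicator_def)

lemma wbdd_add: "wbdd c g \<Longrightarrow> wbdd d h \<Longrightarrow> wbdd (c + d) (\<lambda>x. g x + h x)"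
  unfolding wbdd_def
  by (auto simp: distrib_right intro: order_trans[OF abs_triangle_ineq] add_mono)

lemma wbdd_cmult: "wbdd c g \<Longrightarrow> wbdd (\<bar>a\<bar> * c) (\<lambda>x. a * g x)"
  unfolding wbdd_def by (auto simp: abs_mult mult.assoc intro: mult_left_mono)

lemma wbdd_diff: "wbdd c g \<Longrightarrow> wbdd d h \<Longrightarrow> wbdd (c + d) (\<lambda>x. g x - h x)"
  using wbdd_add[of c g "1 * d" "\<lambda>x. -1 * h x"] wbdd_cmult[of d h "-1"] by simp

lemma wbdd_sum:
  assumes "\<And>i. i \<in> I \<Longrightarrow> wbdd (c i) (g i)"
  shows "wbdd (\<Sum>i\<in>I. c i) (\<lambda>x. \<Sum>i\<in>I. g i x)"
  using assms
proof (induction I rule: infinite_finite_induct)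
  case (insert i I)
  then show ?case
    using wbdd_add[of "c i" "g i" "\<Sum>i\<in>I. c i" "\<lambda>x. \<Sum>i\<in>I. g i x"] by simp
qed (use wbdd_const[of 0] in simp_all)

lemma wbdd_integrable: "wbdd c g \<Longrightarrow> integrable (P x) g"
  by (rule Bochner_Integration.integrable_bound[OF integrable_mult_right[where c = c, OF weight_integrable]])
     (auto dest: wbdd_measurable simp: wbdd_def intro: order_trans[OF _ abs_ge_self])

text \<open>Monotonicity and additivity carry \<open>wbdd\<close> hypotheses because the Bochner
  integral of a non-integrable function is 0 by convention.\<close>

lemma T_mono:
  assumes "wbdd c g" "wbdd d h" "\<And>x. g x \<le> h x"
  shows "T g x \<le> T h x"
  unfolding T_def using assms by (intro integral_mono wbdd_integrable)

lemma T_add: "wbdd c g \<Longrightarrow> wbdd d h \<Longrightarrow> T (\<lambda>x. g x + h x) = (\<lambda>x. T g x + T h x)"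
  unfolding T_def by (auto simp: fun_eq_iff intro!: Bochner_Integration.integral_add wbdd_integrable)

lemma T_diff: "wbdd c g \<Longrightarrow> wbdd d h \<Longrightarrow> T (\<lambda>x. g x - h x) = (\<lambda>x. T g x - T h x)"
  unfolding T_def by (auto simp: fun_eq_iff intro!: Bochner_Integration.integral_diff wbdd_integrable)

lemma T_cmult: "T (\<lambda>x. a * g x) = (\<lambda>x. a * T g x)"
  unfolding T_def by simp

lemma T_const: "T (\<lambda>x. c) = (\<lambda>x. c)"
  using prob_space.prob_space[OF kernel_prob] by (auto simp: T_def fun_eq_iff)

lemma T_nonneg: "(\<And>x. 0 \<le> g x) \<Longrightarrow> 0 \<le> T g x"
  unfolding T_def by simp

lemma T_weight: "T W x \<le> \<rho> * W x + K"
  using drift[of x] const_pos by (cases "x \<in> B") (auto simp: T_def)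

lemma T_measurable [measurable]:
  assumes [measurable]: "g \<in> borel_measurable borel"
  shows "T g \<in> borel_measurable borel"
  unfolding T_def by measurable

text \<open>Since \<open>1 \<le> W\<close>, the additive \<open>K\<close> of the drift is absorbed
  into \<open>K * W x\<close>. The power that builds up in \<open>wbdd_Tn\<close> only serves
  integrability and monotonicity; growth uniform in \<open>n\<close> comes from
  \<open>Tn_weight\<close>.\<close>

lemma wbdd_T:
  assumes "wbdd c g"
  shows "wbdd (c * (\<rho> + K)) (T g)"
  unfolding wbdd_def
proof safe
  show "T g \<in> borel_measurable borel"
    using wbdd_measurable[OF assms] by measurable
  fix x
  have c: "0 \<le> c" by (rule wbdd_nonneg[OF assms])
  have "\<bar>T g x\<bar> \<le> T (\<lambda>x. \<bar>g x\<bar>) x"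
    unfolding T_def by (rule integral_abs_bound)
  also have "\<dots> \<le> T (\<lambda>x. c * W x) x"
    unfolding T_def using wbdd_abs[OF assms]
    by (intro integral_mono integrable_abs wbdd_integrable[OF assms] integrable_mult_right
        weight_integrable)
  also have "\<dots> = c * T W x" by (simp add: T_cmult)
  also have "T W x \<le> (\<rho> + K) * W x"
  proof -
    have "K * 1 \<le> K * W x"
      using const_pos weight_ge_1 by (intro mult_left_mono) auto
    then show ?thesis
      unfolding distrib_right using T_weight[of x] by linarith
  qed
  finally show "\<bar>T g x\<bar> \<le> c * (\<rho> + K) * W x"
    using c by (simp add: mult.assoc mult_left_mono)
qed

lemma wbdd_Tn: "wbdd c g \<Longrightarrow> wbdd (c * (\<rho> + K) ^ n) ((T ^^ n) g)"
  by (induction n) (auto dest: wbdd_T simp: ac_simps)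

lemma Tn_mono:
  assumes "wbdd c g" "wbdd d h" "\<And>x. g x \<le> h x"
  shows "(T ^^ n) g x \<le> (T ^^ n) h x"
  using assms(3) by (induction n arbitrary: x) (auto intro!: T_mono wbdd_Tn assms(1,2))

lemma Tn_add:
  "wbdd c g \<Longrightarrow> wbdd d h \<Longrightarrow> (T ^^ n) (\<lambda>x. g x + h x) = (\<lambda>x. (T ^^ n) g x + (T ^^ n) h x)"
  by (induction n) (auto simp: T_add[OF wbdd_Tn wbdd_Tn])

lemma Tn_diff:
  "wbdd c g \<Longrightarrow> wbdd d h \<Longrightarrow> (T ^^ n) (\<lambda>x. g x - h x) = (\<lambda>x. (T ^^ n) g x - (T ^^ n) h x)"
  by (induction n) (auto simp: T_diff[OF wbdd_Tn wbdd_Tn])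

lemma Tn_cmult: "(T ^^ n) (\<lambda>x. a * g x) = (\<lambda>x. a * (T ^^ n) g x)"
  by (induction n) (auto simp: T_cmult)

lemma Tn_const: "(T ^^ n) (\<lambda>x. c) = (\<lambda>x. c)"
  by (induction n) (auto simp: T_const)

lemma Tn_nonneg: "(\<And>x. 0 \<le> g x) \<Longrightarrow> 0 \<le> (T ^^ n) g x"
  by (induction n arbitrary: x) (auto intro!: T_nonneg)

lemma T_sum:
  assumes "\<And>i. i \<in> I \<Longrightarrow> wbdd (c i) (g i)"
  shows "T (\<lambda>x. \<Sum>i\<in>I. g i x) = (\<lambda>x. \<Sum>i\<in>I. T (g i) x)"
  unfolding T_def by (auto simp: fun_eq_iff intro!: Bochner_Integration.integral_sum wbdd_integrable assms)

text \<open>The number \<open>K / (1 - \<rho>)\<close> is the fixed point of the map sending t to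
  \<rho> t + K, so iterating the drift never exceeds it.\<close>

lemma Tn_weight: "(T ^^ n) W x \<le> \<rho> ^ n * W x + K / (1 - \<rho>)"
proof (induction n arbitrary: x)
  case 0
  then show ?case using rate const_pos by simp
next
  case (Suc n)
  have "(T ^^ Suc n) W x = (T ^^ n) (T W) x"
    by (simp only: funpow_Suc_right comp_apply)
  also have "\<dots> \<le> (T ^^ n) (\<lambda>x. \<rho> * W x + K) x"
    by (rule Tn_mono[OF wbdd_T[OF wbdd_weight]
          wbdd_add[OF wbdd_cmult[OF wbdd_weight] wbdd_const] T_weight])
  also have "\<dots> = \<rho> * (T ^^ n) W x + K"
    by (simp add: Tn_add[OF wbdd_cmult[OF wbdd_weight] wbdd_const] Tn_cmult Tn_const)
  also have "\<dots> \<le> \<rho> * (\<rho> ^ n * W x + K / (1 - \<rho>)) + K"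
    using Suc[of x] rate by simp
  also have "\<dots> = \<rho> ^ Suc n * W x + K / (1 - \<rho>)"
    using rate by (simp add: field_simps)
  finally show ?case .
qed

section \<open>Weighted oscillation seminorm, blind to constants\<close>

definition osc :: "real \<Rightarrow> real \<Rightarrow> ('a \<Rightarrow> real) \<Rightarrow> bool" where
  "osc b L g \<longleftrightarrow> (\<forall>x y. \<bar>g x - g y\<bar> \<le> L * (2 + b * W x + b * W y))"

lemma oscD: "osc b L g \<Longrightarrow> \<bar>g x - g y\<bar> \<le> L * (2 + b * W x + b * W y)"
  by (simp add: osc_def)

lemma osc_nonneg:
  assumes "osc b L g" "0 \<le> b"
  shows "0 \<le> L"
proof -
  have "0 < 2 + b * W undefined + b * W undefined"
    using assms(2) weight_nonneg by (intro add_pos_nonneg) auto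
  moreover have "0 \<le> L * (2 + b * W undefined + b * W undefined)"
    using oscD[OF assms(1), of undefined undefined] by simp
  ultimately show ?thesis
    by (simp add: zero_le_mult_iff)
qed

text \<open>The oscillation bound is a bound on the distance to the constants: any number between
  \<open>sup (g - L (1 + b W))\<close> and \<open>inf (g + L (1 + b W))\<close> can serve as the constant.\<close>

lemma osc_centre:
  assumes "osc b L g"
  obtains a where "\<And>x. \<bar>g x - a\<bar> \<le> L * (1 + b * W x)"
proof
  let ?l = "\<lambda>x. g x - L * (1 + b * W x)"
  let ?u = "\<lambda>x. g x + L * (1 + b * W x)"
  have *: "?l x \<le> ?u y" for x y
    using oscD[OF assms, of x y] by (simp add: algebra_simps abs_le_iff)
  have "bdd_above (range ?l)"
    by (rule bdd_aboveI2[of _ _ "?u undefined"]) (rule *)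
  then have "?l x \<le> (SUP x. ?l x)" for x
    by (intro cSUP_upper) auto
  moreover have "(SUP x. ?l x) \<le> ?u y" for y
    by (intro cSUP_least *) auto
  ultimately show "\<bar>g x - (SUP x. ?l x)\<bar> \<le> L * (1 + b * W x)" for x
    by (smt (verit))
qed

lemma wbdd_osc:
  assumes "wbdd c g" "0 < b"
  shows "osc b (c / b) g"
  unfolding osc_def
proof safe
  fix x y
  have "\<bar>g x - g y\<bar> \<le> c * (W x + W y)"
    using wbdd_abs[OF assms(1), of x] wbdd_abs[OF assms(1), of y] by (simp add: distrib_left)
  also have "\<dots> = c / b * (b * W x + b * W y)"
    using assms(2) by (simp add: field_simps)
  also have "\<dots> \<le> c / b * (2 + b * W x + b * W y)"
    using assms wbdd_nonneg[OF assms(1)] by (intro mult_left_mono) auto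
  finally show "\<bar>g x - g y\<bar> \<le> c / b * (2 + b * W x + b * W y)" .
qed

text \<open>Powers of \<open>T\<close> are monotone and fix constants, so the upper and the lower
  half of the bound on \<open>g - a\<close> each pass through them.\<close>

lemma Tn_centred_bound:
  assumes "wbdd c g" "0 \<le> b" "\<And>x. \<bar>g x - a\<bar> \<le> L * (1 + b * W x)"
  shows "\<bar>(T ^^ n) g x - a\<bar> \<le> L * (1 + b * (T ^^ n) W x)"
proof -
  let ?h = "\<lambda>x. L * (1 + b * W x)"
  have h: "wbdd (\<bar>L\<bar> * (\<bar>1\<bar> + \<bar>b\<bar> * 1)) ?h"
    by (intro wbdd_cmult wbdd_add wbdd_const wbdd_weight)
  have Th: "(T ^^ n) ?h x = L * (1 + b * (T ^^ n) W x)"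
    by (simp add: Tn_cmult Tn_add[OF wbdd_const wbdd_cmult[OF wbdd_weight]] Tn_const)
  have "(T ^^ n) (\<lambda>x. g x - a) x \<le> (T ^^ n) ?h x"
    using assms(3) by (intro Tn_mono[OF wbdd_diff[OF assms(1) wbdd_const] h]) (simp add: abs_le_iff)
  moreover have "(T ^^ n) (\<lambda>x. a - g x) x \<le> (T ^^ n) ?h x"
    using assms(3) by (intro Tn_mono[OF wbdd_diff[OF wbdd_const assms(1)] h]) (simp add: abs_le_iff)
  ultimately show ?thesis
    by (simp add: Th Tn_diff[OF assms(1) wbdd_const] Tn_diff[OF wbdd_const assms(1)] Tn_const)
qed

text \<open>The factor does not depend on \<open>n\<close>. It pays for the \<open>j mod n\<close>
  steps that the contraction leaves over in \<open>geometric_ergodicity\<close>.\<close>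

lemma osc_Tn:
  assumes g: "wbdd c g" and "osc b L g" "0 \<le> b"
  shows "osc b (L * (1 + b * (K / (1 - \<rho>)))) ((T ^^ n) g)"
  unfolding osc_def
proof safe
  fix x y
  obtain a where a: "\<And>x. \<bar>g x - a\<bar> \<le> L * (1 + b * W x)"
    using osc_centre[OF assms(2)] by blast
  define K' where "K' = K / (1 - \<rho>)"
  have L: "0 \<le> L" by (rule osc_nonneg[OF assms(2,3)])
  have K': "0 \<le> K'" using rate const_pos by (simp add: K'_def)
  have TW: "1 + b * (T ^^ n) W z \<le> (1 + b * W z) * (1 + b * K')" for z
  proof -
    have "(T ^^ n) W z \<le> \<rho> ^ n * W z + K'"
      unfolding K'_def by (rule Tn_weight)
    also have "\<dots> \<le> 1 * W z + K'"
      using rate weight_nonneg by (intro add_right_mono mult_right_mono power_le_one) auto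
    finally have "b * (T ^^ n) W z \<le> b * (W z + K')"
      using assms(3) by (simp add: mult_left_mono)
    moreover have "0 \<le> b * W z * (b * K')"
      using assms(3) K' weight_nonneg by simp
    ultimately show ?thesis by (simp add: algebra_simps)
  qed
  have "\<bar>(T ^^ n) g x - (T ^^ n) g y\<bar> \<le> L * (1 + b * (T ^^ n) W x) + L * (1 + b * (T ^^ n) W y)"
    using Tn_centred_bound[OF g assms(3) a, of n x] Tn_centred_bound[OF g assms(3) a, of n y] by linarith
  also have "\<dots> \<le> L * ((1 + b * W x) * (1 + b * K')) + L * ((1 + b * W y) * (1 + b * K'))"
    using L TW by (intro add_mono mult_left_mono)
  also have "\<dots> = L * (1 + b * K') * (2 + b * W x + b * W y)"
    by (simp add: algebra_simps)
  finally show "\<bar>(T ^^ n) g x - (T ^^ n) g y\<bar> \<le> L * (1 + b * (K / (1 - \<rho>))) * (2 + b * W x + b * W y)"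
    by (simp only: K'_def)
qed

end

section \<open>Minorization on \<open>B\<close>, small sets and contraction\<close>

locale harris_kernel = weighted_kernel +
  fixes \<nu> :: "'a measure" and \<delta> :: real
  assumes nu: "\<nu> \<in> space (prob_algebra borel)" and nu_B: "emeasure \<nu> B = 1"
    and delta_pos: "0 < \<delta>"
    and minorization: "x \<in> B \<Longrightarrow> A \<in> sets borel \<Longrightarrow> ennreal \<delta> * emeasure \<nu> A \<le> emeasure (P x) A"
begin

lemma nu_prob: "prob_space \<nu>" and nu_sets [measurable_cong]: "sets \<nu> = sets borel"
  using nu by (auto simp: space_prob_algebra)

lemma scale_nu_le: "x \<in> B \<Longrightarrow> scale_measure (ennreal \<delta>) \<nu> \<le> P x"
  by (subst le_measure) (auto simp: nu_sets kernel_sets minorization)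

lemma minorization_nn_integral:
  assumes x: "x \<in> B" and [measurable]: "f \<in> borel_measurable borel"
  shows "ennreal \<delta> * (\<integral>\<^sup>+y. f y \<partial>\<nu>) \<le> (\<integral>\<^sup>+y. f y \<partial>P x)"
proof -
  have "ennreal \<delta> * (\<integral>\<^sup>+y. f y \<partial>\<nu>) = (\<integral>\<^sup>+y. f y \<partial>scale_measure (ennreal \<delta>) \<nu>)"
    by (rule nn_integral_scale_measure[symmetric]) simp
  also have "\<dots> \<le> (\<integral>\<^sup>+y. f y \<partial>P x)"
    using scale_nu_le[OF x] by (intro nn_integral_mono_measure) (simp_all add: nu_sets kernel_sets)
  finally show ?thesis .
qed

lemma B_nonempty: obtains x where "x \<in> B"
  using nu_B by fastforce

text \<open>From any point \<open>x\<close> of \<open>B\<close>, \<open>P x\<close> dominates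
  \<delta> \<nu>, and \<open>W\<close> is integrable under \<open>P x\<close>.\<close>

lemma nu_weight_integrable: "integrable \<nu> W"
proof (rule integrableI_bounded)
  obtain x where x: "x \<in> B" using B_nonempty .
  have "ennreal \<delta> * (\<integral>\<^sup>+y. ennreal (norm (W y)) \<partial>\<nu>) \<le> (\<integral>\<^sup>+y. ennreal (norm (W y)) \<partial>P x)"
    by (rule minorization_nn_integral[OF x]) simp
  also have "\<dots> < \<infinity>"
    using weight_integrable[of x] by (simp add: integrable_iff_bounded)
  finally show "(\<integral>\<^sup>+y. ennreal (norm (W y)) \<partial>\<nu>) < \<infinity>"
    using delta_pos by (auto simp: ennreal_mult_less_top)
qed simp

lemma nu_integrable: "wbdd c g \<Longrightarrow> integrable \<nu> g"
  by (rule Bochner_Integration.integrable_bound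
        [OF integrable_mult_right[where c = c, OF nu_weight_integrable]])
     (auto dest: wbdd_measurable simp: wbdd_def intro: order_trans[OF _ abs_ge_self])

lemma minorization_T:
  assumes g: "wbdd c g" "\<And>x. 0 \<le> g x"
  shows "\<delta> * (\<integral>y. g y \<partial>\<nu>) * indicator B x \<le> T g x"
proof (cases "x \<in> B")
  case True
  have [measurable]: "g \<in> borel_measurable borel" using g(1) by (rule wbdd_measurable)
  have "ennreal (\<delta> * (\<integral>y. g y \<partial>\<nu>)) = ennreal \<delta> * (\<integral>\<^sup>+y. g y \<partial>\<nu>)"
    using g delta_pos by (simp add: nn_integral_eq_integral nu_integrable ennreal_mult)
  also have "\<dots> \<le> (\<integral>\<^sup>+y. g y \<partial>P x)"
    by (rule minorization_nn_integral[OF True]) simp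
  also have "\<dots> = ennreal (T g x)"
    using g by (simp add: T_def nn_integral_eq_integral wbdd_integrable)
  finally show ?thesis
    using True T_nonneg[of g x, OF g(2)] by (simp add: ennreal_le_iff)
next
  case False
  then show ?thesis using T_nonneg[of g x, OF g(2)] by simp
qed

lemma delta_le_1: "\<delta> \<le> 1"
proof -
  obtain x where x: "x \<in> B" using B_nonempty .
  interpret N: prob_space \<nu> by (rule nu_prob)
  have "\<delta> * (\<integral>y. 1 \<partial>\<nu>) * indicator B x \<le> T (\<lambda>_. 1) x"
    by (rule minorization_T[OF wbdd_const]) simp
  then show ?thesis
    using x N.prob_space by (simp add: T_const)
qed

text \<open>As \<nu> is concentrated on \<open>B\<close>, the minorization makes the chain stay in
  \<open>B\<close> for one more step with probability at least \<delta>.\<close>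

lemma T_indicator_B: "\<delta> * indicator B x \<le> T (indicator B) x"
proof -
  have "(\<integral>y. indicator B y \<partial>\<nu>) = (1::real)"
    using nu_B sets_B by (simp add: measure_def nu_sets)
  moreover have "\<delta> * (\<integral>y. indicator B y \<partial>\<nu>) * indicator B x \<le> T (indicator B) x"
    by (rule minorization_T[OF wbdd_indicator[OF sets_B]]) simp
  ultimately show ?thesis by simp
qed

lemma Tn_indicator_B:
  assumes "k \<le> n"
  shows "\<delta> ^ (n - k) * (T ^^ k) (indicator B) x \<le> (T ^^ n) (indicator B) x"
  using assms
proof (induction n arbitrary: x rule: dec_induct)
  case base
  then show ?case by simp
next
  case (step n)
  have "\<delta> ^ (Suc n - k) * (T ^^ k) (indicator B) x = \<delta> * (\<delta> ^ (n - k) * (T ^^ k) (indicator B) x)"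
    using step by (simp add: Suc_diff_le)
  also have "\<dots> \<le> \<delta> * (T ^^ n) (indicator B) x"
    using step.IH[of x] delta_pos by simp
  also have "\<dots> = (T ^^ n) (\<lambda>x. \<delta> * indicator B x) x"
    by (simp add: Tn_cmult)
  also have "\<dots> \<le> (T ^^ n) (T (indicator B)) x"
    by (rule Tn_mono[OF wbdd_cmult[OF wbdd_indicator] wbdd_T[OF wbdd_indicator] T_indicator_B]) auto
  also have "\<dots> = (T ^^ Suc n) (indicator B) x"
    by (simp only: funpow_Suc_right comp_apply)
  finally show ?case .
qed

text \<open>Iterating the drift with the indicator kept bounds the mean of \<open>W\<close> after
  \<open>n\<close> steps, which is at least 1. Once \<open>\<rho> ^ n * W x\<close> is small, the
  expected number of visits to \<open>B\<close> before time \<open>n\<close> is therefore bounded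
  below.\<close>

lemma one_le_visits:
  "1 \<le> \<rho> ^ n * W x + K * (\<Sum>k<n. (T ^^ k) (indicator B) x)"
proof -
  have "(T ^^ n) W x \<le> \<rho> ^ n * W x + K * (\<Sum>k<n. (T ^^ k) (indicator B) x)" for x
  proof (induction n)
    case (Suc n)
    have "(T ^^ Suc n) W x = (T ^^ n) (T W) x"
      by (simp only: funpow_Suc_right comp_apply)
    also have "\<dots> \<le> (T ^^ n) (\<lambda>x. \<rho> * W x + K * indicator B x) x"
      using drift by (intro Tn_mono[OF wbdd_T[OF wbdd_weight]
            wbdd_add[OF wbdd_cmult[OF wbdd_weight] wbdd_cmult[OF wbdd_indicator]]]) (auto simp: T_def)
    also have "\<dots> = \<rho> * (T ^^ n) W x + K * (T ^^ n) (indicator B) x"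
      by (simp add: Tn_add[OF wbdd_cmult[OF wbdd_weight] wbdd_cmult[OF wbdd_indicator]] Tn_cmult)
    also have "\<rho> * (T ^^ n) W x \<le> \<rho> ^ Suc n * W x + \<rho> * (K * (\<Sum>k<n. (T ^^ k) (indicator B) x))"
      using mult_left_mono[OF Suc, of \<rho>] rate by (simp add: algebra_simps)
    also have "\<rho> * (K * (\<Sum>k<n. (T ^^ k) (indicator B) x)) \<le> 1 * (K * (\<Sum>k<n. (T ^^ k) (indicator B) x))"
      using rate const_pos
      by (intro mult_right_mono mult_nonneg_nonneg sum_nonneg Tn_nonneg) auto
    finally show ?case by (simp add: distrib_left)
  qed simp
  moreover have "(T ^^ n) (\<lambda>_. 1) x \<le> (T ^^ n) W x"
    by (rule Tn_mono[OF wbdd_const wbdd_weight weight_ge_1])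
  ultimately show ?thesis
    by (simp add: Tn_const) (meson order_trans)
qed

text \<open>By the drift condition the chain started in \<open>{W \<le> R}\<close> visits \<open>B\<close> before a fixed time with
  a probability bounded below, and by the minorization it can be held in \<open>B\<close> until that time.\<close>

lemma sublevel_small:
  obtains n \<alpha> where "0 < n" "0 < \<alpha>" "\<alpha> \<le> 1"
    "\<And>c g x. wbdd c g \<Longrightarrow> (\<And>x. 0 \<le> g x) \<Longrightarrow> W x \<le> R \<Longrightarrow> \<alpha> * (\<integral>y. g y \<partial>\<nu>) \<le> (T ^^ n) g x"
proof -
  define R' where "R' = max R 1"
  have R': "0 < R'" "R \<le> R'" by (auto simp: R'_def)
  have "(\<lambda>n. \<rho> ^ n) \<longlonglongrightarrow> 0" using rate by (intro LIMSEQ_power_zero) auto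
  then have "eventually (\<lambda>n. \<rho> ^ n < 1 / (2 * R')) sequentially"
    using R'(1) by (intro order_tendstoD) auto
  then obtain n0 where n0: "\<rho> ^ n < 1 / (2 * R')" if "n \<ge> n0" for n
    by (auto simp: eventually_sequentially)
  define n where "n = Suc n0"
  have n: "\<rho> ^ n * R' < 1 / 2" "0 < n"
    using n0[of n] R'(1) by (auto simp: n_def field_simps)
  \<comment> \<open>The \<open>n\<close> visit probabilities sum to at least 1 / (2 K), and holding
    the chain in \<open>B\<close> until time \<open>n\<close> turns each of them into at most
    \<open>(T ^^ n) (indicator B) x / \<delta> ^ n\<close>.\<close>
  define \<eta> where "\<eta> = \<delta> ^ n / (2 * K * n)"
  have eta: "0 < \<eta>" using delta_pos const_pos n(2) by (simp add: \<eta>_def)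
  have vis: "\<eta> \<le> (T ^^ n) (indicator B) x" if "W x \<le> R" for x
  proof -
    have "\<rho> ^ n * W x \<le> \<rho> ^ n * R'"
      using that R' rate by (intro mult_left_mono) auto
    with n(1) have "\<rho> ^ n * W x < 1 / 2" by linarith
    then have "1 / 2 \<le> K * (\<Sum>k<n. (T ^^ k) (indicator B) x)"
      using one_le_visits[of n x] by linarith
    also have "\<dots> \<le> K * (\<Sum>k<n. (T ^^ n) (indicator B) x / \<delta> ^ n)"
    proof (intro mult_left_mono sum_mono)
      fix k assume "k \<in> {..<n}"
      then have k: "k \<le> n" by simp
      have "\<delta> ^ n * (T ^^ k) (indicator B) x \<le> \<delta> ^ (n - k) * (T ^^ k) (indicator B) x"
        using delta_pos delta_le_1 by (intro mult_right_mono power_decreasing Tn_nonneg) auto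
      also have "\<dots> \<le> (T ^^ n) (indicator B) x" by (rule Tn_indicator_B[OF k])
      finally show "(T ^^ k) (indicator B) x \<le> (T ^^ n) (indicator B) x / \<delta> ^ n"
        using delta_pos by (simp add: field_simps)
    qed (use const_pos in simp)
    finally show ?thesis
      using const_pos delta_pos n(2) by (simp add: \<eta>_def field_simps)
  qed
  show thesis
  proof
    \<comment> \<open>One further step, taken from \<open>B\<close>, distributes the chain according
      to \<nu> with weight \<delta>; the minimum with 1 keeps the constant a probability.\<close>
    show "0 < Suc n" "0 < min 1 (\<eta> * \<delta>)" "min 1 (\<eta> * \<delta>) \<le> 1"
      using eta delta_pos by auto
    fix c g x assume g: "wbdd c g" "\<And>x. 0 \<le> g x" and x: "W x \<le> R"
    have nu_g: "0 \<le> (\<integral>y. g y \<partial>\<nu>)" using g(2) by simp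
    have "min 1 (\<eta> * \<delta>) * (\<integral>y. g y \<partial>\<nu>) \<le> (\<eta> * \<delta>) * (\<integral>y. g y \<partial>\<nu>)"
      by (rule mult_right_mono[OF _ nu_g]) simp
    also have "\<dots> = \<eta> * (\<delta> * (\<integral>y. g y \<partial>\<nu>))"
      by simp
    also have "\<dots> \<le> (T ^^ n) (indicator B) x * (\<delta> * (\<integral>y. g y \<partial>\<nu>))"
      using vis[OF x] delta_pos nu_g by (intro mult_right_mono) auto
    also have "\<dots> = (T ^^ n) (\<lambda>x. \<delta> * (\<integral>y. g y \<partial>\<nu>) * indicator B x) x"
      by (simp add: Tn_cmult)
    also have "\<dots> \<le> (T ^^ n) (T g) x"
      by (rule Tn_mono[OF wbdd_cmult[OF wbdd_indicator[OF sets_B]] wbdd_T[OF g(1)] minorization_T[OF g]])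
    also have "\<dots> = (T ^^ Suc n) g x"
      by (simp only: funpow_Suc_right comp_apply)
    finally show "min 1 (\<eta> * \<delta>) * (\<integral>y. g y \<partial>\<nu>) \<le> (T ^^ Suc n) g x" .
  qed
qed

text \<open>There are two regimes for the pair of points. If \<open>W x + W y\<close> is large, the
  drift shrinks the weight; if it is small, both points lie in a small set and share a portion
  \<alpha> of \<nu>, which cancels in the difference.\<close>

theorem contraction:
  obtains n b \<gamma> where "0 < n" "0 < b" "0 < \<gamma>" "\<gamma> < 1"
    "\<And>c L g. wbdd c g \<Longrightarrow> osc b L g \<Longrightarrow> osc b (\<gamma> * L) ((T ^^ n) g)"
proof -
  define K' where "K' = K / (1 - \<rho>)"
  \<comment> \<open>Chosen so that \<open>\<rho> * s + 2 * K' \<le> \<rho>' * s\<close> as soon as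
    \<open>R \<le> s\<close>, where \<rho>' is halfway between \<rho> and 1.\<close>
  define R where "R = 4 * K' / (1 - \<rho>)"
  define \<rho>' where "\<rho>' = (1 + \<rho>) / 2"
  have K': "0 < K'" using const_pos rate by (simp add: K'_def)
  have R: "0 < R" using K' rate by (simp add: R_def)
  have rho': "0 < \<rho>'" "\<rho>' < 1" using rate by (auto simp: \<rho>'_def)
  obtain n \<alpha> where n: "0 < n" and alpha: "0 < \<alpha>" "\<alpha> \<le> 1" and
    small: "\<And>c g x. wbdd c g \<Longrightarrow> (\<And>x. 0 \<le> g x) \<Longrightarrow> W x \<le> R \<Longrightarrow> \<alpha> * (\<integral>y. g y \<partial>\<nu>) \<le> (T ^^ n) g x"
    using sublevel_small[of R] by blast
  \<comment> \<open>The minorization gains 2 \<alpha> in the constant part and the drift loses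
    \<open>2 * b * K'\<close>; this \<open>b\<close> makes the loss equal to \<alpha>, so a net gain
    of \<alpha> remains.\<close>
  define b where "b = \<alpha> / (2 * K')"
  have b: "0 < b" "2 * b * K' = \<alpha>" using alpha K' by (auto simp: b_def)
  \<comment> \<open>The ratio \<open>(2 + b * \<rho>' * s) / (2 + b * s)\<close> decreases in
    \<open>s\<close>; this is its value at \<open>s = R\<close>, the worst case of the first
    regime.\<close>
  define \<gamma>\<^sub>1 where "\<gamma>\<^sub>1 = (2 + b * \<rho>' * R) / (2 + b * R)"
  define \<gamma> where "\<gamma> = max \<gamma>\<^sub>1 (max (1 - \<alpha> / 2) \<rho>)"
  have bR: "0 < b * R" using b R by simp
  have "b * \<rho>' * R < b * R" using b R rho' by simp
  then have "\<gamma>\<^sub>1 < 1" using bR by (simp add: \<gamma>\<^sub>1_def)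
  then have gamma: "0 < \<gamma>" "\<gamma> < 1" "\<gamma>\<^sub>1 \<le> \<gamma>" "1 - \<alpha> / 2 \<le> \<gamma>" "\<rho> \<le> \<gamma>"
    using rate alpha by (auto simp: \<gamma>_def)
  interpret N: prob_space \<nu> by (rule nu_prob)

  have TW: "(T ^^ n) W x \<le> \<rho> * W x + K'" for x
  proof -
    have "\<rho> ^ n \<le> \<rho> ^ 1" using n rate by (intro power_decreasing) auto
    then have "\<rho> ^ n * W x \<le> \<rho> * W x" using weight_nonneg by (simp add: mult_right_mono)
    with Tn_weight[of n x] show ?thesis by (simp add: K'_def)
  qed

  have "osc b (\<gamma> * L) ((T ^^ n) g)" if g: "wbdd c g" "osc b L g" for c L g
    unfolding osc_def
  proof safe
    fix x y
    have L: "0 \<le> L" using osc_nonneg[OF g(2)] b by simp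
    obtain a where a: "\<And>x. \<bar>g x - a\<bar> \<le> L * (1 + b * W x)"
      using osc_centre[OF g(2)] by blast
    define s where "s = W x + W y"
    have s: "0 < s" "(T ^^ n) W x + (T ^^ n) W y \<le> \<rho> * s + 2 * K'"
      using TW[of x] TW[of y] weight_pos[of x] weight_pos[of y] by (auto simp: s_def distrib_left)
    have bs: "0 \<le> b * s" using b s by simp
    have "\<bar>(T ^^ n) g x - (T ^^ n) g y\<bar> \<le> L * (\<gamma> * (2 + b * s))"
    proof (cases "R \<le> s")
      case True
      have "\<bar>(T ^^ n) g x - (T ^^ n) g y\<bar> \<le> L * (1 + b * (T ^^ n) W x) + L * (1 + b * (T ^^ n) W y)"
        using Tn_centred_bound[OF g(1) less_imp_le[OF b(1)] a, of n x]
          Tn_centred_bound[OF g(1) less_imp_le[OF b(1)] a, of n y] by linarith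
      also have "\<dots> = L * (2 + b * ((T ^^ n) W x + (T ^^ n) W y))"
        by (simp add: algebra_simps)
      also have "\<dots> \<le> L * (2 + b * (\<rho>' * s))"
      proof (intro mult_left_mono add_left_mono L)
        have "4 * K' \<le> (1 - \<rho>) * s"
          using True rate by (simp add: R_def field_simps)
        then have "\<rho> * s + 2 * K' \<le> \<rho>' * s"
          by (simp add: \<rho>'_def field_simps)
        with s(2) show "(T ^^ n) W x + (T ^^ n) W y \<le> \<rho>' * s" by linarith
      qed (use b in simp)
      also have "\<dots> \<le> L * (\<gamma>\<^sub>1 * (2 + b * s))"
      proof (intro mult_left_mono L)
        have "(2 + b * (\<rho>' * s)) * (2 + b * R) \<le> (2 + b * \<rho>' * R) * (2 + b * s)"
        proof -
          have "0 \<le> 2 * b * (1 - \<rho>') * (s - R)"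
            using b rho' True by simp
          then show ?thesis by (simp add: algebra_simps)
        qed
        then show "2 + b * (\<rho>' * s) \<le> \<gamma>\<^sub>1 * (2 + b * s)"
          using bR by (simp add: \<gamma>\<^sub>1_def field_simps)
      qed
      also have "\<dots> \<le> L * (\<gamma> * (2 + b * s))"
        using gamma L bs by (intro mult_left_mono mult_right_mono) auto
      finally show ?thesis .
    next
      case False
      have W_le: "W x \<le> R" "W y \<le> R"
        using False weight_nonneg[of x] weight_nonneg[of y] by (auto simp: s_def)
      define m where "m = (\<integral>z. g z - a \<partial>\<nu>)"
      \<comment> \<open>The centre \<open>a + \<alpha> * m\<close> is the same for all
        \<open>z\<close> in the sublevel set. The bound follows from the small set property of the
        two nonnegative functions \<open>h + (g - a)\<close> and \<open>h - (g - a)\<close>.\<close>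
      have *: "\<bar>(T ^^ n) g z - a - \<alpha> * m\<bar> \<le> L * (1 - \<alpha> + b * (T ^^ n) W z)" if z: "W z \<le> R" for z
      proof -
        define h where "h = (\<lambda>z. L * (1 + b * W z))"
        have h: "wbdd (\<bar>L\<bar> * (\<bar>1\<bar> + \<bar>b\<bar> * 1)) h"
          unfolding h_def by (intro wbdd_cmult wbdd_add wbdd_const wbdd_weight)
        have h': "L \<le> (\<integral>z. h z \<partial>\<nu>)"
        proof -
          have "(\<integral>z. h z \<partial>\<nu>) = L * (1 + b * (\<integral>z. W z \<partial>\<nu>))"
            unfolding h_def using N.prob_space nu_weight_integrable by simp
          moreover have "0 \<le> (\<integral>z. W z \<partial>\<nu>)"
            by (rule Bochner_Integration.integral_nonneg) (rule weight_nonneg)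
          ultimately show ?thesis
            using L b mult_left_mono[of 1 "1 + b * (\<integral>z. W z \<partial>\<nu>)" L] by (simp only:) simp
        qed
        have ga: "wbdd (c + \<bar>a\<bar>) (\<lambda>z. g z - a)"
          by (rule wbdd_diff[OF g(1) wbdd_const])
        have Th: "(T ^^ n) h z = L * (1 + b * (T ^^ n) W z)"
          by (simp add: h_def Tn_cmult Tn_add[OF wbdd_const wbdd_cmult[OF wbdd_weight]] Tn_const)
        have Tga: "(T ^^ n) (\<lambda>z. g z - a) z = (T ^^ n) g z - a"
          by (simp add: Tn_diff[OF g(1) wbdd_const] Tn_const)
        have "\<alpha> * (\<integral>z. h z + (g z - a) \<partial>\<nu>) \<le> (T ^^ n) (\<lambda>z. h z + (g z - a)) z"
          using a by (intro small[OF wbdd_add[OF h ga] _ z]) (smt (verit) h_def)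
        also have "(\<integral>z. h z + (g z - a) \<partial>\<nu>) = (\<integral>z. h z \<partial>\<nu>) + m"
          unfolding m_def by (intro Bochner_Integration.integral_add nu_integrable[OF h] nu_integrable[OF ga])
        finally have 1: "\<alpha> * (\<integral>z. h z \<partial>\<nu>) + \<alpha> * m \<le> (T ^^ n) h z + ((T ^^ n) g z - a)"
          by (simp add: Tn_add[OF h ga] Tga distrib_left)
        have "\<alpha> * (\<integral>z. h z - (g z - a) \<partial>\<nu>) \<le> (T ^^ n) (\<lambda>z. h z - (g z - a)) z"
          using a by (intro small[OF wbdd_diff[OF h ga] _ z]) (smt (verit) h_def)
        also have "(\<integral>z. h z - (g z - a) \<partial>\<nu>) = (\<integral>z. h z \<partial>\<nu>) - m"
          unfolding m_def by (intro Bochner_Integration.integral_diff nu_integrable[OF h] nu_integrable[OF ga])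
        finally have 2: "\<alpha> * (\<integral>z. h z \<partial>\<nu>) - \<alpha> * m \<le> (T ^^ n) h z - ((T ^^ n) g z - a)"
          by (simp add: Tn_diff[OF h ga] Tga right_diff_distrib)
        have "\<alpha> * L \<le> \<alpha> * (\<integral>z. h z \<partial>\<nu>)"
          using h' alpha by simp
        moreover have "L * (1 - \<alpha> + b * (T ^^ n) W z) = (T ^^ n) h z - \<alpha> * L"
          by (simp add: Th algebra_simps)
        ultimately show ?thesis
          using 1 2 by (simp add: abs_le_iff)
      qed
      have "\<bar>(T ^^ n) g x - (T ^^ n) g y\<bar> \<le> L * (1 - \<alpha> + b * (T ^^ n) W x) + L * (1 - \<alpha> + b * (T ^^ n) W y)"
        using *[OF W_le(1)] *[OF W_le(2)] by linarith
      also have "\<dots> = L * (2 * (1 - \<alpha>) + b * ((T ^^ n) W x + (T ^^ n) W y))"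
        by (simp add: algebra_simps)
      also have "\<dots> \<le> L * (2 * (1 - \<alpha>) + b * (\<rho> * s + 2 * K'))"
        using L b s(2) by (intro mult_left_mono add_left_mono) auto
      also have "\<dots> = L * ((1 - \<alpha> / 2) * 2 + \<rho> * (b * s))"
        using b(2) by (simp add: algebra_simps)
      also have "\<dots> \<le> L * (\<gamma> * 2 + \<gamma> * (b * s))"
        using L gamma bs by (intro mult_left_mono add_mono mult_right_mono) auto
      finally show ?thesis by (simp add: distrib_left)
    qed
    then show "\<bar>(T ^^ n) g x - (T ^^ n) g y\<bar> \<le> \<gamma> * L * (2 + b * W x + b * W y)"
      by (simp add: s_def algebra_simps)
  qed
  then show thesis
    using that n b(1) gamma(1,2) by blast
qed

theorem geometric_ergodicity:
  obtains D s where "0 \<le> D" "0 < s" "s < 1"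
    "\<And>c g j x y. wbdd c g \<Longrightarrow> \<bar>(T ^^ j) g x - (T ^^ j) g y\<bar> \<le> D * c * s ^ j * (W x + W y)"
proof -
  obtain n b \<gamma> where n: "0 < n" and b: "0 < b" and gamma: "0 < \<gamma>" "\<gamma> < 1"
    and contr: "\<And>c L g. wbdd c g \<Longrightarrow> osc b L g \<Longrightarrow> osc b (\<gamma> * L) ((T ^^ n) g)"
    using contraction by metis
  have iter: "osc b (\<gamma> ^ q * L) ((T ^^ (n * q)) g)" if "wbdd c g" "osc b L g" for q c L g
  proof (induction q)
    case (Suc q)
    have "osc b (\<gamma> * (\<gamma> ^ q * L)) ((T ^^ n) ((T ^^ (n * q)) g))"
      by (rule contr[OF wbdd_Tn[OF that(1)] Suc])
    then show ?case
      by (simp add: funpow_add mult.assoc)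
  qed (use that in simp)
  define M where "M = 1 + b * (K / (1 - \<rho>))"
  \<comment> \<open>The contraction acts once every \<open>n\<close> steps; the root spreads its
    factor evenly over single steps.\<close>
  define s where "s = root n \<gamma>"
  have M: "0 \<le> M" using b const_pos rate by (simp add: M_def)
  have s: "0 < s" "s < 1" "s ^ n = \<gamma>"
    using n gamma by (auto simp: s_def)
  show thesis
  proof
    \<comment> \<open>The factors of the constant: 1 / b turns a \<open>wbdd\<close> bound into an
      oscillation bound, \<open>M\<close> covers the leftover steps, 1 / \<gamma> the rounding of
      \<open>j\<close> down to a multiple of \<open>n\<close>, and 1 + b uses
      \<open>1 \<le> W\<close>.\<close>
    show "0 \<le> M / b / \<gamma> * (1 + b)" "0 < s" "s < 1"
      using M b gamma s by auto
    fix c g j x y assume g: "wbdd c g"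
    let ?q = "j div n" and ?r = "j mod n"
    have c: "0 \<le> c" by (rule wbdd_nonneg[OF g])
    have "osc b (\<gamma> ^ ?q * (c / b * M)) ((T ^^ (n * ?q)) ((T ^^ ?r) g))"
      unfolding M_def using b g by (intro iter[OF wbdd_Tn[OF g]] osc_Tn[OF g] wbdd_osc) auto
    moreover have "(T ^^ (n * ?q)) ((T ^^ ?r) g) = (T ^^ j) g"
      by (metis comp_apply funpow_add mult_div_mod_eq)
    ultimately have "\<bar>(T ^^ j) g x - (T ^^ j) g y\<bar> \<le> \<gamma> ^ ?q * (c / b * M) * (2 + b * W x + b * W y)"
      using oscD by fastforce
    also have "\<dots> \<le> (s ^ j / \<gamma>) * (c / b * M) * ((1 + b) * (W x + W y))"
    proof (intro mult_mono mult_nonneg_nonneg)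
      have "s ^ n * \<gamma> ^ ?q \<le> s ^ ?r * \<gamma> ^ ?q"
        using s gamma n by (intro mult_right_mono power_decreasing) auto
      also have "\<dots> = s ^ j"
        unfolding s(3)[symmetric] by (metis mult.commute mult_div_mod_eq power_add power_mult)
      finally show "\<gamma> ^ ?q \<le> s ^ j / \<gamma>"
        using gamma s by (simp add: field_simps)
      show "2 + b * W x + b * W y \<le> (1 + b) * (W x + W y)"
        using weight_ge_1[of x] weight_ge_1[of y] by (simp add: algebra_simps)
      show "0 \<le> 2 + b * W x + b * W y"
        using b weight_nonneg by (auto intro!: add_nonneg_nonneg)
    qed (use c b M s gamma in auto)
    also have "\<dots> = M / b / \<gamma> * (1 + b) * c * s ^ j * (W x + W y)"
      by (simp add: mult_ac)
    finally show "\<bar>(T ^^ j) g x - (T ^^ j) g y\<bar> \<le> M / b / \<gamma> * (1 + b) * c * s ^ j * (W x + W y)" .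
  qed
qed

end

section \<open>Invariant measure and convergence to the mean\<close>

locale invariant_harris_kernel = harris_kernel +
  fixes \<pi> :: "'a measure"
  assumes pi: "\<pi> \<in> space (prob_algebra borel)" and invariant: "\<pi> \<bind> P = \<pi>"
begin

lemma pi_prob: "prob_space \<pi>" and pi_sets [measurable_cong]: "sets \<pi> = sets borel"
  using pi by (auto simp: space_prob_algebra)

lemma nn_integral_invariant:
  assumes [measurable]: "f \<in> borel_measurable borel"
  shows "(\<integral>\<^sup>+x. \<integral>\<^sup>+y. f y \<partial>P x \<partial>\<pi>) = (\<integral>\<^sup>+x. f x \<partial>\<pi>)"
proof -
  have "P \<in> \<pi> \<rightarrow>\<^sub>M subprob_algebra borel" by measurable
  from nn_integral_bind[OF assms this] show ?thesis by (simp add: invariant)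
qed

lemma nn_integral_T_invariant:
  assumes g: "wbdd c g" "\<And>x. 0 \<le> g x"
  shows "(\<integral>\<^sup>+x. T g x \<partial>\<pi>) = (\<integral>\<^sup>+x. g x \<partial>\<pi>)"
proof -
  have [measurable]: "g \<in> borel_measurable borel" using g(1) by (rule wbdd_measurable)
  have "(\<integral>\<^sup>+x. T g x \<partial>\<pi>) = (\<integral>\<^sup>+x. \<integral>\<^sup>+y. g y \<partial>P x \<partial>\<pi>)"
    using g by (simp add: T_def nn_integral_eq_integral wbdd_integrable)
  then show ?thesis by (simp add: nn_integral_invariant)
qed

text \<open>Integrating the drift against \<pi> suggests that (1 - \<rho>) times the mean of
  \<open>W\<close> is at most \<open>K\<close>, but this subtracts a mean not yet known to be
  finite. The subtraction is made for the truncations \<open>min (W x) n\<close>, followed by a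
  monotone limit.\<close>

lemma pi_weight_integrable: "integrable \<pi> W"
proof (rule integrableI_bounded)
  interpret \<pi>: prob_space \<pi> by (rule pi_prob)
  have trunc: "(\<integral>\<^sup>+x. ennreal ((1 - \<rho>) * (W x * indicator {x. W x \<le> real n} x)) \<partial>\<pi>) \<le> ennreal K" for n
  proof -
    define h where "h = (\<lambda>x. min (W x) (real n))"
    have h: "wbdd 1 h" "0 \<le> h x" "h x \<le> W x" "h x \<le> real n" for x
      using weight_nonneg by (auto simp: h_def wbdd_def)
    have [measurable]: "h \<in> borel_measurable borel" using h(1) by (rule wbdd_measurable)
    have "(\<integral>\<^sup>+x. h x \<partial>\<pi>) \<le> (\<integral>\<^sup>+x. ennreal (real n) \<partial>\<pi>)"
      using h(4) by (intro nn_integral_mono ennreal_leI)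
    also have "\<dots> < \<infinity>" by (simp add: \<pi>.emeasure_space_1)
    finally have fin: "(\<integral>\<^sup>+x. h x \<partial>\<pi>) < \<infinity>" .
    \<comment> \<open>Below the level \<open>n\<close> this is the drift for \<open>W\<close>; above
      it the truncation equals \<open>n\<close>, which \<open>T h\<close> cannot exceed.\<close>
    have pw: "(1 - \<rho>) * (W x * indicator {x. W x \<le> real n} x) + T h x \<le> K + h x" for x
    proof (cases "W x \<le> real n")
      case True
      have "T h x \<le> T W x" by (rule T_mono[OF h(1) wbdd_weight h(3)])
      with T_weight[of x] True show ?thesis by (simp add: h_def algebra_simps)
    next
      case False
      have "T h x \<le> T (\<lambda>_. real n) x" by (rule T_mono[OF h(1) wbdd_const h(4)])
      with False const_pos show ?thesis by (simp add: T_const h_def)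
    qed
    have "(\<integral>\<^sup>+x. ennreal ((1 - \<rho>) * (W x * indicator {x. W x \<le> real n} x)) \<partial>\<pi>) + (\<integral>\<^sup>+x. h x \<partial>\<pi>)
        = (\<integral>\<^sup>+x. ennreal ((1 - \<rho>) * (W x * indicator {x. W x \<le> real n} x)) \<partial>\<pi>) + (\<integral>\<^sup>+x. T h x \<partial>\<pi>)"
      by (simp add: nn_integral_T_invariant[OF h(1,2)])
    also have "\<dots> = (\<integral>\<^sup>+x. ennreal ((1 - \<rho>) * (W x * indicator {x. W x \<le> real n} x)) + ennreal (T h x) \<partial>\<pi>)"
      by (rule nn_integral_add[symmetric]) measurable
    also have "\<dots> \<le> (\<integral>\<^sup>+x. ennreal K + ennreal (h x) \<partial>\<pi>)"
    proof (rule nn_integral_mono)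
      fix x
      have "0 \<le> (1 - \<rho>) * (W x * indicator {x. W x \<le> real n} x)"
        using rate weight_nonneg by simp
      then show "ennreal ((1 - \<rho>) * (W x * indicator {x. W x \<le> real n} x)) + ennreal (T h x)
          \<le> ennreal K + ennreal (h x)"
        using pw[of x] T_nonneg[of h x, OF h(2)] h(2)[of x] const_pos
        by (simp flip: ennreal_plus add: ennreal_leI)
    qed
    also have "\<dots> = ennreal K + (\<integral>\<^sup>+x. h x \<partial>\<pi>)"
      by (subst nn_integral_add) (auto simp: \<pi>.emeasure_space_1)
    finally show ?thesis
      using fin by (auto simp: add.commute ennreal_add_left_cancel_le)
  qed
  have "(\<integral>\<^sup>+x. ennreal ((1 - \<rho>) * W x) \<partial>\<pi>) =
      (\<integral>\<^sup>+x. (SUP n. ennreal ((1 - \<rho>) * (W x * indicator {x. W x \<le> real n} x))) \<partial>\<pi>)"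
  proof (rule nn_integral_cong)
    fix x
    obtain n where n: "W x \<le> real n" using real_arch_simple by blast
    show "ennreal ((1 - \<rho>) * W x) = (SUP n. ennreal ((1 - \<rho>) * (W x * indicator {x. W x \<le> real n} x)))"
    proof (rule antisym)
      show "ennreal ((1 - \<rho>) * W x) \<le> (SUP n. ennreal ((1 - \<rho>) * (W x * indicator {x. W x \<le> real n} x)))"
        using n by (intro SUP_upper2[of n]) auto
      show "(SUP n. ennreal ((1 - \<rho>) * (W x * indicator {x. W x \<le> real n} x))) \<le> ennreal ((1 - \<rho>) * W x)"
        using rate weight_nonneg[of x] by (intro SUP_least ennreal_leI mult_left_mono) (auto simp: indicator_def)
    qed
  qed
  also have "\<dots> = (SUP n. \<integral>\<^sup>+x. ennreal ((1 - \<rho>) * (W x * indicator {x. W x \<le> real n} x)) \<partial>\<pi>)"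
    using rate weight_nonneg
    by (intro nn_integral_monotone_convergence_SUP)
       (auto simp: incseq_def le_fun_def indicator_def intro!: ennreal_leI)
  also have "\<dots> \<le> ennreal K" by (intro SUP_least trunc)
  also have "(\<integral>\<^sup>+x. ennreal ((1 - \<rho>) * W x) \<partial>\<pi>) = ennreal (1 - \<rho>) * (\<integral>\<^sup>+x. W x \<partial>\<pi>)"
    using rate weight_nonneg by (simp add: ennreal_mult nn_integral_cmult)
  finally have "ennreal (1 - \<rho>) * (\<integral>\<^sup>+x. W x \<partial>\<pi>) < \<infinity>"
    using ennreal_less_top le_less_trans by fastforce
  then show "(\<integral>\<^sup>+x. ennreal (norm (W x)) \<partial>\<pi>) < \<infinity>"
    using rate weight_nonneg by (auto simp: ennreal_mult_less_top)
qed simp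

lemma pi_integrable: "wbdd c g \<Longrightarrow> integrable \<pi> g"
  by (rule Bochner_Integration.integrable_bound
        [OF integrable_mult_right[where c = c, OF pi_weight_integrable]])
     (auto dest: wbdd_measurable simp: wbdd_def intro: order_trans[OF _ abs_ge_self])

text \<open>Adding \<open>c * W x\<close> makes the function nonnegative, where invariance is known;
  the added term is then removed by linearity.\<close>

lemma integral_T_invariant:
  assumes g: "wbdd c g"
  shows "(\<integral>x. T g x \<partial>\<pi>) = (\<integral>x. g x \<partial>\<pi>)"
proof -
  have nonneg: "(\<integral>x. T h x \<partial>\<pi>) = (\<integral>x. h x \<partial>\<pi>)" if h: "wbdd a h" "\<And>x. 0 \<le> h x" for a h
  proof -
    have "ennreal (\<integral>x. T h x \<partial>\<pi>) = ennreal (\<integral>x. h x \<partial>\<pi>)"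
      using nn_integral_T_invariant[OF h] T_nonneg[of h, OF h(2)] h
      by (simp add: nn_integral_eq_integral pi_integrable[OF h(1)] pi_integrable[OF wbdd_T[OF h(1)]])
    then show ?thesis
      using T_nonneg[of h, OF h(2)] h(2) by simp
  qed
  have cW: "wbdd (\<bar>c\<bar> * 1) (\<lambda>x. c * W x)"
    by (rule wbdd_cmult[OF wbdd_weight])
  have "(\<integral>x. T (\<lambda>x. g x + c * W x) x \<partial>\<pi>) = (\<integral>x. g x + c * W x \<partial>\<pi>)"
  proof (rule nonneg[OF wbdd_add[OF g cW]])
    show "0 \<le> g x + c * W x" for x
      using wbdd_abs[OF g, of x] by linarith
  qed
  moreover have "(\<integral>x. T (\<lambda>x. c * W x) x \<partial>\<pi>) = (\<integral>x. c * W x \<partial>\<pi>)"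
    using wbdd_nonneg[OF g] weight_nonneg by (intro nonneg[OF cW]) auto
  ultimately show ?thesis
    by (simp add: T_add[OF g cW] pi_integrable[OF g] pi_weight_integrable pi_integrable[OF cW]
        pi_integrable[OF wbdd_T[OF g]] pi_integrable[OF wbdd_T[OF cW]])
qed

lemma integral_Tn_invariant:
  assumes "wbdd c g"
  shows "(\<integral>x. (T ^^ n) g x \<partial>\<pi>) = (\<integral>x. g x \<partial>\<pi>)"
  by (induction n) (simp_all add: integral_T_invariant[OF wbdd_Tn[OF assms]])

text \<open>Average the two-point estimate over \<open>y\<close> under \<pi>: by invariance the mean
  of \<open>(T ^^ j) g\<close> is that of \<open>g\<close>.\<close>

lemma convergence_to_mean:
  obtains D s where "0 \<le> D" "0 < s" "s < 1"
    "\<And>c g j x. wbdd c g \<Longrightarrow>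
       \<bar>(T ^^ j) g x - (\<integral>y. g y \<partial>\<pi>)\<bar> \<le> D * c * s ^ j * (W x + (\<integral>y. W y \<partial>\<pi>))"
proof -
  interpret \<pi>: prob_space \<pi> by (rule pi_prob)
  obtain D s where D: "0 \<le> D" and s: "0 < s" "s < 1" and
    ergodic: "\<And>c g j x y. wbdd c g \<Longrightarrow> \<bar>(T ^^ j) g x - (T ^^ j) g y\<bar> \<le> D * c * s ^ j * (W x + W y)"
    using geometric_ergodicity by metis
  have "\<bar>(T ^^ j) g x - (\<integral>y. g y \<partial>\<pi>)\<bar> \<le> D * c * s ^ j * (W x + (\<integral>y. W y \<partial>\<pi>))"
    if g: "wbdd c g" for c g j x
  proof -
    have [simp]: "integrable \<pi> ((T ^^ j) g)" by (rule pi_integrable[OF wbdd_Tn[OF g]])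
    have "(T ^^ j) g x - (\<integral>y. g y \<partial>\<pi>) = (\<integral>y. (T ^^ j) g x - (T ^^ j) g y \<partial>\<pi>)"
      using \<pi>.prob_space by (simp add: integral_Tn_invariant[OF g])
    also have "\<bar>\<dots>\<bar> \<le> (\<integral>y. \<bar>(T ^^ j) g x - (T ^^ j) g y\<bar> \<partial>\<pi>)"
      by (rule integral_abs_bound)
    also have "\<dots> \<le> (\<integral>y. D * c * s ^ j * (W x + W y) \<partial>\<pi>)"
      by (intro integral_mono ergodic[OF g] integrable_abs integrable_mult_right
          Bochner_Integration.integrable_add Bochner_Integration.integrable_diff
          pi_weight_integrable) simp_all
    also have "\<dots> = D * c * s ^ j * (W x + (\<integral>y. W y \<partial>\<pi>))"
      using \<pi>.prob_space pi_weight_integrable by simp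
    finally show ?thesis .
  qed
  with that D s show thesis by blast
qed

text \<open>Iterating \<open>f (n + 1) = T (f n) - d n\<close> expresses \<open>f m - \<integral> f m d\<pi>\<close> through the deviations of
  \<open>T\<^sup>j (d (m - 1 - j))\<close> from its mean. These decay geometrically in \<open>j\<close>, uniformly in \<open>m\<close>, and for fixed
  \<open>j\<close> vanish almost everywhere as \<open>m\<close> grows, because the means of the defects \<open>d\<close> have a finite sum.\<close>

theorem subsolution_convergence:
  assumes f: "\<And>n. wbdd c (f n)" and sub: "\<And>n x. f (Suc n) x \<le> T (f n) x"
  shows "\<exists>a. AE x in \<pi>. (\<lambda>n. f n x) \<longlonglongrightarrow> a"
proof -
  interpret \<pi>: prob_space \<pi> by (rule pi_prob)
  define d where "d n = (\<lambda>x. T (f n) x - f (Suc n) x)" for n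
  define c' where "c' = c * (\<rho> + K) + c"
  define a where "a n = (\<integral>x. f n x \<partial>\<pi>)" for n
  define e where "e n = (\<integral>x. d n x \<partial>\<pi>)" for n
  have d: "wbdd c' (d n)" for n
    unfolding d_def c'_def by (intro wbdd_diff wbdd_T f)
  have d_nonneg: "0 \<le> d n x" for n x
    using sub by (simp add: d_def)
  have e_nonneg: "0 \<le> e n" for n
    unfolding e_def using d_nonneg by simp
  have a_Suc: "a (Suc n) = a n - e n" for n
    by (simp add: a_def e_def d_def integral_T_invariant[OF f] pi_integrable[OF f]
        pi_integrable[OF wbdd_T[OF f]])
  \<comment> \<open>The means of \<open>f n\<close> decrease by \<open>e n\<close> and stay bounded,
    so the defects have a finite total mass.\<close>
  have a_eq: "a m = a 0 - (\<Sum>k<m. e k)" for m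
    by (induction m) (simp_all add: a_Suc)
  have a_bound: "\<bar>a n\<bar> \<le> c * (\<integral>x. W x \<partial>\<pi>)" for n
  proof -
    have "\<bar>a n\<bar> \<le> (\<integral>x. \<bar>f n x\<bar> \<partial>\<pi>)" unfolding a_def by (rule integral_abs_bound)
    also have "\<dots> \<le> (\<integral>x. c * W x \<partial>\<pi>)"
      by (intro integral_mono wbdd_abs[OF f] integrable_abs pi_integrable[OF f]
          integrable_mult_right pi_weight_integrable)
    finally show ?thesis by simp
  qed
  have "summable e"
  proof (rule bounded_imp_summable[OF e_nonneg])
    show "(\<Sum>k\<le>n. e k) \<le> a 0 + c * (\<integral>x. W x \<partial>\<pi>)" for n
      using a_eq[of "Suc n"] a_bound[of "Suc n"] by (simp add: lessThan_Suc_atMost)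
  qed
  then have e_lim: "e \<longlonglongrightarrow> 0" by (rule summable_LIMSEQ_zero)
  obtain l where a_lim: "a \<longlonglongrightarrow> l"
  proof -
    have "(\<lambda>m. a 0 - (\<Sum>k<m. e k)) \<longlonglongrightarrow> a 0 - suminf e"
      by (intro tendsto_intros summable_LIMSEQ \<open>summable e\<close>)
    moreover have "(\<lambda>m. a 0 - (\<Sum>k<m. e k)) = a"
      by (rule ext) (rule a_eq[symmetric])
    ultimately show thesis using that by simp
  qed
  \<comment> \<open>Discrete variation of constants. The natural subtraction
    \<open>m - 1 - j\<close> is exact, as \<open>j < m\<close> in the sum.\<close>
  have expand: "f m x = (T ^^ m) (f 0) x - (\<Sum>j<m. (T ^^ j) (d (m - 1 - j)) x)" for m x
  proof (induction m arbitrary: x)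
    case (Suc m)
    have IH: "f m = (\<lambda>x. (T ^^ m) (f 0) x - (\<Sum>j<m. (T ^^ j) (d (m - 1 - j)) x))"
      using Suc by blast
    have "f (Suc m) x = T (f m) x - d m x" by (simp add: d_def)
    also have "T (f m) x = (T ^^ Suc m) (f 0) x - (\<Sum>j<m. (T ^^ Suc j) (d (m - 1 - j)) x)"
      by (subst IH, subst T_diff[OF wbdd_Tn[OF f] wbdd_sum[OF wbdd_Tn[OF d]]],
          subst T_sum[OF wbdd_Tn[OF d]]) simp
    finally have "f (Suc m) x = (T ^^ Suc m) (f 0) x - (\<Sum>j<m. (T ^^ Suc j) (d (m - 1 - j)) x) - d m x" .
    moreover have "(\<Sum>j<Suc m. (T ^^ j) (d (Suc m - 1 - j)) x) =
        d m x + (\<Sum>j<m. (T ^^ Suc j) (d (m - 1 - j)) x)"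
      by (subst sum.lessThan_Suc_shift) simp
    ultimately show ?case by linarith
  qed simp
  obtain D s where D: "0 \<le> D" and s: "0 < s" "s < 1" and
    mean: "\<And>c g j x. wbdd c g \<Longrightarrow>
       \<bar>(T ^^ j) g x - (\<integral>y. g y \<partial>\<pi>)\<bar> \<le> D * c * s ^ j * (W x + (\<integral>y. W y \<partial>\<pi>))"
    using convergence_to_mean by metis
  have "AE x in \<pi>. \<forall>j. (\<lambda>n. (T ^^ j) (d n) x) \<longlonglongrightarrow> 0"
    unfolding AE_all_countable
  proof
    fix j
    have Td: "integrable \<pi> ((T ^^ j) (d n))" "0 \<le> (T ^^ j) (d n) x" for n x
      using d_nonneg by (auto intro: pi_integrable[OF wbdd_Tn[OF d]] Tn_nonneg)
    \<comment> \<open>By Tonelli and invariance the sum over \<open>n\<close> has the finite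
      integral \<open>\<Sum>n. e n\<close>; it is thus finite almost everywhere and its terms tend
      to 0.\<close>
    have "(\<integral>\<^sup>+x. (\<Sum>n. ennreal ((T ^^ j) (d n) x)) \<partial>\<pi>) = (\<Sum>n. \<integral>\<^sup>+x. ennreal ((T ^^ j) (d n) x) \<partial>\<pi>)"
      using Td(1) by (intro nn_integral_suminf) (auto intro: borel_measurable_integrable)
    also have "\<dots> = (\<Sum>n. ennreal (e n))"
      using Td by (simp add: nn_integral_eq_integral integral_Tn_invariant[OF d] e_def)
    also have "\<dots> \<noteq> \<infinity>"
      using \<open>summable e\<close> e_nonneg by (simp add: suminf_ennreal2)
    finally have "AE x in \<pi>. (\<Sum>n. ennreal ((T ^^ j) (d n) x)) \<noteq> \<infinity>"
      using Td(1) by (intro nn_integral_PInf_AE borel_measurable_suminf measurable_ennreal)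
        (auto intro: borel_measurable_integrable)
    then show "AE x in \<pi>. (\<lambda>n. (T ^^ j) (d n) x) \<longlonglongrightarrow> 0"
    proof eventually_elim
      case (elim x)
      then show ?case
        using Td(2) by (intro summable_LIMSEQ_zero summable_suminf_not_top) auto
    qed
  qed
  then have "AE x in \<pi>. (\<lambda>n. f n x) \<longlonglongrightarrow> l"
  proof eventually_elim
    case (elim x)
    define I where "I = W x + (\<integral>y. W y \<partial>\<pi>)"
    \<comment> \<open>Padding by 0 beyond \<open>m\<close> turns the sums of varying length into
      full series, to which Tannery's theorem (dominated convergence for series) applies.\<close>
    define u where "u j m = (if j < m then (T ^^ j) (d (m - 1 - j)) x - e (m - 1 - j) else 0)" for j m
    have geo: "(\<lambda>j. D * C * s ^ j * I) \<longlonglongrightarrow> 0" "summable (\<lambda>j. D * C * s ^ j * I)" for C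
      using s by (auto intro!: tendsto_mult_left_zero tendsto_mult_right_zero LIMSEQ_power_zero
          summable_mult summable_mult2 summable_geometric)
    have "((\<lambda>m. \<Sum>j. u j m) \<longlongrightarrow> (\<Sum>j. 0)) sequentially"
    proof (rule tannerys_theorem[THEN conjunct2, THEN conjunct2])
      show "u j \<longlonglongrightarrow> 0" for j
      \<comment> \<open>Shifting by \<open>Suc j\<close> puts the index in the first branch of
        \<open>u\<close> and turns \<open>m - 1 - j\<close> into \<open>m\<close>.\<close>
      proof (rule LIMSEQ_offset[of _ "Suc j"])
        have "(\<lambda>m. (T ^^ j) (d m) x - e m) \<longlonglongrightarrow> 0 - 0"
          using elim e_lim by (intro tendsto_diff) auto
        then show "(\<lambda>m. u j (m + Suc j)) \<longlonglongrightarrow> 0" by (simp add: u_def)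
      qed
      show "\<forall>\<^sub>F (j, m) in sequentially \<times>\<^sub>F sequentially. norm (u j m) \<le> D * c' * s ^ j * I"
      proof (rule always_eventually, safe)
        fix j m
        have "0 \<le> c'" by (rule wbdd_nonneg[OF d])
        moreover have "0 \<le> I"
          unfolding I_def using weight_nonneg by (intro add_nonneg_nonneg Bochner_Integration.integral_nonneg)
        ultimately show "norm (u j m) \<le> D * c' * s ^ j * I"
          using mean[OF d] D s by (auto simp: u_def e_def I_def)
      qed
    qed (use geo in auto)
    moreover have "(\<Sum>j. u j m) = (\<Sum>j<m. (T ^^ j) (d (m - 1 - j)) x) - (\<Sum>k<m. e k)" for m
    proof -
      have "(\<Sum>j. u j m) = (\<Sum>j<m. u j m)"
        by (rule suminf_finite) (auto simp: u_def)
      also have "\<dots> = (\<Sum>j<m. (T ^^ j) (d (m - 1 - j)) x) - (\<Sum>j<m. e (m - 1 - j))"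
        by (simp add: u_def sum_subtractf)
      also have "(\<Sum>j<m. e (m - 1 - j)) = (\<Sum>k<m. e k)"
        using sum.nat_diff_reindex[of e m] by simp
      finally show ?thesis .
    qed
    ultimately have u_lim: "(\<lambda>m. (\<Sum>j<m. (T ^^ j) (d (m - 1 - j)) x) - (\<Sum>k<m. e k)) \<longlonglongrightarrow> 0"
      by simp
    have "(\<lambda>m. (T ^^ m) (f 0) x - a 0) \<longlonglongrightarrow> 0"
      by (rule Lim_null_comparison[OF always_eventually geo(1)[of c]])
         (use mean[OF f] in \<open>simp add: I_def a_def\<close>)
    from tendsto_add[OF tendsto_diff[OF this u_lim] a_lim]
    have "(\<lambda>m. (T ^^ m) (f 0) x - a 0
        - ((\<Sum>j<m. (T ^^ j) (d (m - 1 - j)) x) - (\<Sum>k<m. e k)) + a m) \<longlonglongrightarrow> l"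
      by simp
    moreover have "(T ^^ m) (f 0) x - a 0
        - ((\<Sum>j<m. (T ^^ j) (d (m - 1 - j)) x) - (\<Sum>k<m. e k)) + a m = f m x" for m
      using a_eq[of m] expand[of m x] by linarith
    ultimately show ?case by simp
  qed
  then show ?thesis by blast
qed

end

section \<open>Value iteration\<close>

lemma eintegral_integrable:
  assumes "integrable N f"
  shows "eintegral N (\<lambda>y. ereal (f y)) = ereal (\<integral>y. f y \<partial>N)"
proof -
  have fin: "(\<integral>\<^sup>+y. ennreal (f y) \<partial>N) \<noteq> \<infinity>" "(\<integral>\<^sup>+y. ennreal (- f y) \<partial>N) \<noteq> \<infinity>"
    using assms by (auto simp: real_integrable_def)
  then obtain r s where "(\<integral>\<^sup>+y. ennreal (f y) \<partial>N) = ennreal r" "0 \<le> r"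
    "(\<integral>\<^sup>+y. ennreal (- f y) \<partial>N) = ennreal s" "0 \<le> s"
    by (metis ennreal_cases infinity_ennreal_def)
  then show ?thesis
    using assms by (simp add: eintegral_def real_lebesgue_integral_def)
qed

text \<open>A lower bound makes the negative part integrable on a finite measure, so integrability
  can fail only through the value \<infinity>. Finiteness of a Bellman expression can then be read
  as integrability.\<close>

lemma eintegral_bounded_below:
  assumes "finite_measure N" and f: "f \<in> borel_measurable N" "\<And>y. m \<le> f y"
  shows "integrable N f \<or> eintegral N (\<lambda>y. ereal (f y)) = \<infinity>"
proof -
  interpret finite_measure N by fact
  have "(\<integral>\<^sup>+y. ennreal (- f y) \<partial>N) \<le> (\<integral>\<^sup>+y. ennreal (- m) \<partial>N)"
    using f(2) by (intro nn_integral_mono ennreal_leI) simp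
  also have "\<dots> < \<infinity>"
    by (auto simp: ennreal_mult_eq_top_iff less_top[symmetric])
  finally have neg: "(\<integral>\<^sup>+y. ennreal (- f y) \<partial>N) < \<infinity>" .
  show ?thesis
  proof (cases "(\<integral>\<^sup>+y. ennreal (f y) \<partial>N) = \<infinity>")
    case True
    obtain s where "(\<integral>\<^sup>+y. ennreal (- f y) \<partial>N) = ennreal s" "0 \<le> s"
      using neg by (metis ennreal_cases infinity_ennreal_def less_irrefl)
    with True show ?thesis by (simp add: eintegral_def)
  next
    case False
    with neg f(1) have "integrable N f" by (auto simp: real_integrable_def)
    then show ?thesis by blast
  qed
qed

text \<open>Provides the compact set of states to which \<open>K_inf_compact\<close> is applied
  along a convergent sequence.\<close>

lemma compact_insert_limit:
  fixes X :: "nat \<Rightarrow> 'a::topological_space"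
  assumes "X \<longlonglongrightarrow> l"
  shows "compact (insert l (range X))"
  unfolding compact_eq_Heine_Borel
proof safe
  fix C assume C: "\<forall>t\<in>C. open t" "insert l (range X) \<subseteq> \<Union>C"
  then obtain t where t: "t \<in> C" "l \<in> t" by blast
  then have "eventually (\<lambda>n. X n \<in> t) sequentially"
    using assms C(1) by (auto intro: topological_tendstoD)
  then obtain N where N: "X n \<in> t" if "N \<le> n" for n
    by (auto simp: eventually_sequentially)
  have "compact (X ` {..<N})" by (simp add: finite_imp_compact)
  moreover have "X ` {..<N} \<subseteq> \<Union>C" using C(2) by blast
  ultimately obtain D where D: "D \<subseteq> C" "finite D" "X ` {..<N} \<subseteq> \<Union>D"
    using C(1) unfolding compact_eq_Heine_Borel by meson
  have "X n \<in> \<Union>(insert t D)" for n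
    using N[of n] D(3) by (cases "n < N") auto
  then have "insert l (range X) \<subseteq> \<Union>(insert t D)"
    using t(2) by blast
  with D t(1) show "\<exists>D\<subseteq>C. finite D \<and> insert l (range X) \<subseteq> \<Union>D"
    by (intro exI[of _ "insert t D"]) simp
qed

section \<open>Bellman operator: finiteness, lower semicontinuity, measurable minima\<close>

locale continuous_mdp =
  fixes M :: "('x::polish_space, 'u::polish_space) mdp"
  assumes mdp: "is_mdp M" and basic: "basic_assumption M" and beta_finite: "beta M < \<infinity>"
begin

text \<open>Real version of the cost minus \<open>beta M\<close>. An infinite cost is sent to 0 by
  \<open>enn2real\<close>, so the value is meaningful only where the cost is finite.\<close>

definition rcost :: "'x \<times> 'u \<Rightarrow> real" where
  "rcost z = enn2real (cost M z) - enn2real (beta M)"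

lemma KK_iff: "(x, u) \<in> KK M \<longleftrightarrow> u \<in> actions M x"
  by (simp add: KK_def)

lemma kernel_prob: "z \<in> KK M \<Longrightarrow> prob_space (kernel M z)"
  and kernel_sets: "z \<in> KK M \<Longrightarrow> sets (kernel M z) = sets borel"
proof -
  assume "z \<in> KK M"
  then have "z \<in> space (restrict_space borel (KK M))" by (simp add: space_restrict_space)
  moreover have "kernel M \<in> restrict_space borel (KK M) \<rightarrow>\<^sub>M prob_algebra borel"
    using mdp by (simp add: is_mdp_def)
  ultimately have "kernel M z \<in> space (prob_algebra borel)"
    by (rule measurable_space[rotated])
  then show "prob_space (kernel M z)" "sets (kernel M z) = sets borel"
    by (auto simp: space_prob_algebra)
qed

lemma cost_ge_1: "z \<in> KK M \<Longrightarrow> 1 \<le> cost M z"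
  using mdp by (auto simp: is_mdp_def)

lemma cost_real: "cost M z < \<infinity> \<Longrightarrow> cost M z = ennreal (enn2real (cost M z))"
  by (simp add: less_top)

lemma enn2real_cost_ge_1:
  assumes "z \<in> KK M" "cost M z < \<infinity>"
  shows "1 \<le> enn2real (cost M z)"
  using cost_ge_1[OF assms(1)] cost_real[OF assms(2)]
  by (metis ennreal_1 ennreal_le_iff enn2real_nonneg)

lemma bellman_eq:
  assumes "cost M (x, u) < \<infinity>" "integrable (kernel M (x, u)) f"
  shows "bellman M f x u = ereal (rcost (x, u) + (\<integral>y. f y \<partial>kernel M (x, u)))"
proof -
  have "enn2ereal (cost M (x, u)) = ereal (enn2real (cost M (x, u)))"
    using cost_real[OF assms(1)] by (metis enn2ereal_ennreal enn2real_nonneg)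
  moreover have "enn2ereal (beta M) = ereal (enn2real (beta M))"
    using beta_finite by (metis enn2ereal_ennreal enn2real_nonneg ennreal_enn2real infinity_ennreal_def)
  ultimately show ?thesis
    by (simp add: bellman_def eintegral_integrable[OF assms(2)] rcost_def)
qed

text \<open>Infinities cannot cancel: the cost is nonnegative and the integral of a function bounded
  below is never negative infinite.\<close>

lemma bellman_finite:
  assumes z: "(x, u) \<in> KK M" and f: "f \<in> borel_measurable borel" "\<And>y. m \<le> f y"
    and fin: "bellman M f x u < \<infinity>"
  shows "cost M (x, u) < \<infinity>" "integrable (kernel M (x, u)) f"
proof -
  interpret prob_space "kernel M (x, u)" by (rule kernel_prob[OF z])
  have "f \<in> borel_measurable (kernel M (x, u))"
    using f(1) kernel_sets[OF z] by (simp cong: measurable_cong_sets)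
  from eintegral_bounded_below[OF finite_measure_axioms this f(2)]
  have int: "integrable (kernel M (x, u)) f \<or> eintegral (kernel M (x, u)) (\<lambda>y. ereal (f y)) = \<infinity>" .
  have b: "enn2ereal (beta M) = ereal (enn2real (beta M))"
    using beta_finite by (metis enn2ereal_ennreal enn2real_nonneg ennreal_enn2real infinity_ennreal_def)
  have c0: "enn2ereal (cost M (x, u)) \<noteq> - \<infinity>"
    using enn2ereal_nonneg[of "cost M (x, u)"] by auto
  show "integrable (kernel M (x, u)) f"
  proof (rule ccontr)
    assume "\<not> ?thesis"
    with int have "eintegral (kernel M (x, u)) (\<lambda>y. ereal (f y)) = \<infinity>" by blast
    with fin c0 show False
      by (cases "enn2ereal (cost M (x, u))") (simp_all add: bellman_def b)
  qed
  then have e: "eintegral (kernel M (x, u)) (\<lambda>y. ereal (f y)) = ereal (\<integral>y. f y \<partial>kernel M (x, u))"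
    by (rule eintegral_integrable)
  show "cost M (x, u) < \<infinity>"
  proof (rule ccontr)
    assume "\<not> ?thesis"
    then have "cost M (x, u) = \<infinity>" by (simp flip: less_top)
    with fin show False by (simp add: bellman_def b e)
  qed
qed

text \<open>Sequential form of lower semicontinuity. The bound may vary with \<open>k\<close>
  because in \<open>bellman_lsc\<close> it contains an integral that converges along the
  sequence.\<close>

lemma cost_sequence_bound:
  assumes z: "\<And>k::nat. z k \<in> KK M" "z \<longlonglongrightarrow> z0" "z0 \<in> KK M"
    and t: "t \<longlonglongrightarrow> t0" and le: "\<And>k. cost M (z k) \<le> ennreal (t k)"
  shows "cost M z0 \<le> ennreal t0"
proof (rule ccontr)
  assume "\<not> ?thesis"
  then obtain r where r: "ennreal t0 < r" "r < cost M z0"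
    using dense[of "ennreal t0" "cost M z0"] by (auto simp: not_le)
  then obtain r' where r': "r = ennreal r'" "0 \<le> r'"
    by (metis ennreal_cases not_less_iff_gr_or_eq top.not_eq_extremum)
  have "t0 < r'" using r(1) r' by (simp add: ennreal_less_iff) (metis ennreal_leI leD leI r(1) r'(1))
  then have "eventually (\<lambda>k. t k < r') sequentially" using t by (rule order_tendstoD(2)[rotated])
  moreover obtain U where U: "open U" "{z \<in> KK M. r < cost M z} = KK M \<inter> U"
    using basic unfolding basic_assumption_def lsc_on_def openin_open by metis
  have "z0 \<in> U" using U(2) z(3) r(2) by blast
  then have "eventually (\<lambda>k. z k \<in> U) sequentially"
    using z(2) U(1) by (simp add: topological_tendstoD)
  ultimately have "eventually (\<lambda>k. False) sequentially"
  proof eventually_elim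
    case (elim k)
    then have "r < cost M (z k)" using U(2) z(1) by blast
    also have "\<dots> \<le> ennreal (t k)" by (rule le)
    also have "\<dots> \<le> r" using elim(1) r' by (simp add: ennreal_leI)
    finally show ?case by simp
  qed
  then show False by simp
qed

text \<open>Strong continuity concerns bounded functions only, so \<open>f\<close> is truncated at
  \<open>N\<close>. The truncated integral moves to the right-hand side, leaving the cost alone to
  pass to the limit; monotone convergence in \<open>N\<close> then recovers
  \<open>f\<close>.\<close>

lemma bellman_lsc:
  assumes z: "\<And>k::nat. (X k, U k) \<in> KK M" "(\<lambda>k. (X k, U k)) \<longlonglongrightarrow> (x, u)" "(x, u) \<in> KK M"
    and f: "f \<in> borel_measurable borel" "\<And>y. m \<le> f y"
    and le: "\<And>k. bellman M f (X k) (U k) \<le> ereal a"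
  shows "bellman M f x u \<le> ereal a"
proof -
  have [measurable]: "f \<in> borel_measurable borel" by fact
  define b where "b = enn2real (beta M)"
  define g where "g N = (\<lambda>y. min (f y) (real N))" for N :: nat
  have g_meas [measurable]: "g N \<in> borel_measurable borel" for N by (simp add: g_def)
  have g_bounded: "bounded (range (g N))" for N
  proof (rule boundedI)
    fix r assume "r \<in> range (g N)"
    then obtain y where "r = g N y" by blast
    then show "norm r \<le> \<bar>m\<bar> + real N" using f(2)[of y] by (auto simp: g_def min_def)
  qed
  have g_int: "integrable (kernel M w) (g N)" if w: "w \<in> KK M" for w N
  proof -
    interpret prob_space "kernel M w" by (rule kernel_prob[OF w])
    obtain C where "\<And>y. norm (g N y) \<le> C" using g_bounded[of N] by (auto simp: bounded_iff)
    then show ?thesis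
      by (intro integrable_const_bound[of _ C]) (simp_all add: measurable_cong_sets[OF kernel_sets[OF w] refl])
  qed
  have fin: "cost M (X k, U k) < \<infinity>" "integrable (kernel M (X k, U k)) f" for k
    using bellman_finite[OF z(1)[of k] f le_less_trans[OF le[of k]]] by simp_all
  have "cost M (x, u) \<le> ennreal (a + b - (\<integral>y. g N y \<partial>kernel M (x, u)))" for N
  proof (rule cost_sequence_bound[OF z])
    have "continuous_on (KK M) (\<lambda>z. \<integral>y. g N y \<partial>kernel M z)"
      using basic g_meas g_bounded unfolding basic_assumption_def by blast
    then have "(\<lambda>k. \<integral>y. g N y \<partial>kernel M (X k, U k)) \<longlonglongrightarrow> (\<integral>y. g N y \<partial>kernel M (x, u))"
      by (rule continuous_on_tendsto_compose[OF _ z(2,3)]) (simp add: z(1))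
    then show "(\<lambda>k. a + b - (\<integral>y. g N y \<partial>kernel M (X k, U k))) \<longlonglongrightarrow> a + b - (\<integral>y. g N y \<partial>kernel M (x, u))"
      by (intro tendsto_intros)
    fix k
    have "(\<integral>y. g N y \<partial>kernel M (X k, U k)) \<le> (\<integral>y. f y \<partial>kernel M (X k, U k))"
      by (intro integral_mono g_int[OF z(1)] fin(2)) (simp add: g_def)
    moreover have "rcost (X k, U k) + (\<integral>y. f y \<partial>kernel M (X k, U k)) \<le> a"
      using le[of k] by (simp add: bellman_eq[OF fin])
    ultimately have "enn2real (cost M (X k, U k)) \<le> a + b - (\<integral>y. g N y \<partial>kernel M (X k, U k))"
      by (simp add: rcost_def b_def)
    then show "cost M (X k, U k) \<le> ennreal (a + b - (\<integral>y. g N y \<partial>kernel M (X k, U k)))"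
      using cost_real[OF fin(1)[of k]] by (metis ennreal_leI)
  qed
  note bound = this
  have c: "cost M (x, u) < \<infinity>" using bound[of 0] by (simp add: le_less_trans)
  have int_bound: "(\<integral>y. g N y \<partial>kernel M (x, u)) \<le> a - rcost (x, u)" for N
  proof -
    have "ennreal (enn2real (cost M (x, u))) \<le> ennreal (a + b - (\<integral>y. g N y \<partial>kernel M (x, u)))"
      using bound[of N] cost_real[OF c] by simp
    \<comment> \<open>As the cost is at least 1, the right-hand side cannot be a negative number
      hidden by \<open>ennreal\<close>.\<close>
    then have "enn2real (cost M (x, u)) \<le> a + b - (\<integral>y. g N y \<partial>kernel M (x, u))"
      using enn2real_cost_ge_1[OF z(3) c] by (auto simp: ennreal_le_iff2)
    then show ?thesis by (simp add: rcost_def b_def)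
  qed
  have "incseq (\<lambda>N. \<integral>y. g N y \<partial>kernel M (x, u))"
    by (intro incseq_SucI integral_mono g_int z(3)) (auto simp: g_def)
  then obtain L where L: "(\<lambda>N. \<integral>y. g N y \<partial>kernel M (x, u)) \<longlonglongrightarrow> L"
    "\<And>N. (\<integral>y. g N y \<partial>kernel M (x, u)) \<le> L"
    using int_bound incseq_convergent by blast
  have "(\<lambda>N. g N y) \<longlonglongrightarrow> f y" for y
  proof (rule tendsto_eventually)
    obtain n where n: "f y \<le> real n" using real_arch_simple by blast
    show "eventually (\<lambda>N. g N y = f y) sequentially"
      using eventually_ge_at_top[of n] by eventually_elim (use n in \<open>simp add: g_def\<close>)
  qed
  then have lim: "AE y in kernel M (x, u). (\<lambda>N. g N y) \<longlonglongrightarrow> f y" by simp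
  have mono: "AE y in kernel M (x, u). mono (\<lambda>N. g N y)" by (auto simp: mono_def g_def)
  have f_meas: "f \<in> borel_measurable (kernel M (x, u))"
    by (simp add: measurable_cong_sets[OF kernel_sets[OF z(3)] refl])
  note mc = g_int[OF z(3)] mono lim L(1) f_meas
  have "L \<le> a - rcost (x, u)" by (rule LIMSEQ_le_const2[OF L(1)]) (use int_bound in blast)
  then show ?thesis
    using integral_monotone_convergence[OF mc]
    by (simp add: bellman_eq[OF c integrable_monotone_convergence[OF mc]])
qed

lemma attains_minD:
  assumes "attains_min (bellman M f x) (actions M x) (ereal r)"
  obtains u where "(x, u) \<in> KK M" "bellman M f x u = ereal r"
  using assms by (auto simp: attains_min_def is_arg_min_def KK_iff)

lemma attains_min_le:
  assumes "attains_min (bellman M f x) (actions M x) (ereal r)" "(x, w) \<in> KK M"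
  shows "ereal r \<le> bellman M f x w"
  using assms by (auto simp: attains_min_def is_arg_min_def KK_iff not_less)

lemma bellman_minimum_lower_bound:
  assumes f: "f \<in> borel_measurable borel" "\<And>y. m \<le> f y"
    and min: "attains_min (bellman M f x) (actions M x) (ereal r)"
  shows "1 - enn2real (beta M) + m \<le> r"
proof -
  obtain u where u: "(x, u) \<in> KK M" "bellman M f x u = ereal r" using min by (rule attains_minD)
  interpret prob_space "kernel M (x, u)" by (rule kernel_prob[OF u(1)])
  have fin: "cost M (x, u) < \<infinity>" "integrable (kernel M (x, u)) f"
    using bellman_finite[OF u(1) f] u(2) by auto
  have "m \<le> (\<integral>y. f y \<partial>kernel M (x, u))"
    using f(2) by (intro integral_ge_const[OF fin(2)]) auto
  then show ?thesis
    using u(2) enn2real_cost_ge_1[OF u(1) fin(1)] by (simp add: bellman_eq[OF fin] rcost_def)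
qed

text \<open>The sublevel sets are closed: minimizers along a convergent sequence of states have
  bounded cost, hence a limit point by compactness, and the Bellman expression is lower
  semicontinuous there.\<close>

lemma bellman_minimum_measurable:
  assumes compact: "K_inf_compact M" and f: "f \<in> borel_measurable borel" "\<And>y. m \<le> f y"
    and min: "\<And>x. attains_min (bellman M f x) (actions M x) (ereal (g x))"
  shows "g \<in> borel_measurable borel"
proof (rule borel_measurable_iff_le[THEN iffD2, rule_format])
  fix a
  have "closed {x. g x \<le> a}"
    unfolding closed_sequential_limits
  proof safe
    fix X l assume X: "\<forall>n. X n \<in> {x. g x \<le> a}" "X \<longlonglongrightarrow> l"
    have "\<exists>u. (X n, u) \<in> KK M \<and> bellman M f (X n) u = ereal (g (X n))" for n
      using attains_minD[OF min[of "X n"]] by metis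
    then obtain U where U: "\<And>n. (X n, U n) \<in> KK M" "\<And>n. bellman M f (X n) (U n) = ereal (g (X n))"
      by metis
    have le: "bellman M f (X n) (U n) \<le> ereal a" for n
      using U(2)[of n] X(1) by simp
    define \<kappa> where "\<kappa> = a + enn2real (beta M) - m"
    have "cost M (X n, U n) \<le> ennreal \<kappa>" for n
    proof -
      have fin: "cost M (X n, U n) < \<infinity>" "integrable (kernel M (X n, U n)) f"
        using bellman_finite[OF U(1)[of n] f] U(2)[of n] by auto
      interpret prob_space "kernel M (X n, U n)" by (rule kernel_prob[OF U(1)])
      have "m \<le> (\<integral>y. f y \<partial>kernel M (X n, U n))"
        using f(2) by (intro integral_ge_const[OF fin(2)]) auto
      moreover have "rcost (X n, U n) + (\<integral>y. f y \<partial>kernel M (X n, U n)) \<le> a"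
        using le[of n] by (simp add: bellman_eq[OF fin])
      ultimately have "enn2real (cost M (X n, U n)) \<le> \<kappa>" by (simp add: rcost_def \<kappa>_def)
      then show ?thesis using cost_real[OF fin(1)] by (metis ennreal_leI)
    qed
    then have in_C: "(X n, U n) \<in> {z \<in> (insert l (range X) \<times> UNIV) \<inter> KK M. cost M z \<le> ennreal \<kappa>}" for n
      using U(1) by auto
    have "compact {z \<in> (insert l (range X) \<times> UNIV) \<inter> KK M. cost M z \<le> ennreal \<kappa>}"
      using compact compact_insert_limit[OF X(2)] unfolding K_inf_compact_def by blast
    then obtain z r where z: "z \<in> KK M" "strict_mono r" "((\<lambda>n. (X n, U n)) \<circ> r) \<longlonglongrightarrow> z"
      using in_C compact_imp_seq_compact unfolding seq_compact_def by (metis (no_types, lifting) Int_iff mem_Collect_eq)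
    have "(\<lambda>n. fst (((\<lambda>n. (X n, U n)) \<circ> r) n)) \<longlonglongrightarrow> fst z"
      by (rule tendsto_fst[OF z(3)])
    moreover have "(\<lambda>n. fst (((\<lambda>n. (X n, U n)) \<circ> r) n)) \<longlonglongrightarrow> l"
      using LIMSEQ_subseq_LIMSEQ[OF X(2) z(2)] by (simp add: comp_def)
    ultimately have "fst z = l" by (rule LIMSEQ_unique)
    then obtain u where u: "z = (l, u)" by (metis prod.collapse)
    have "bellman M f l u \<le> ereal a"
      by (rule bellman_lsc[of "X \<circ> r" "U \<circ> r", OF _ _ _ f]) (use z U(1) le u in \<open>auto simp: comp_def\<close>)
    moreover have "ereal (g l) \<le> bellman M f l u"
      using attains_min_le[OF min] z(1) u by blast
    ultimately show "g l \<le> a" by (metis ereal_less_eq(3) order_trans)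
  qed
  then show "{x \<in> space borel. g x \<le> a} \<in> sets borel" by simp
qed

lemma value_iteration_regular:
  assumes "K_inf_compact M" and \<Phi>0: "\<Phi> 0 \<in> borel_measurable borel" "bdd_below (range (\<Phi> 0))"
    and iter: "value_iteration M \<Phi>"
  shows "\<Phi> n \<in> borel_measurable borel \<and> bdd_below (range (\<Phi> n))"
proof (induction n)
  case (Suc n)
  then obtain m where m: "\<Phi> n \<in> borel_measurable borel" "\<And>y. m \<le> \<Phi> n y"
    by (auto simp: bdd_below_def)
  have min: "attains_min (bellman M (\<Phi> n) x) (actions M x) (ereal (\<Phi> (Suc n) x))" for x
    using iter by (simp add: value_iteration_def)
  show ?case
    using bellman_minimum_measurable[OF assms(1) m min] bellman_minimum_lower_bound[OF m min]
    by (intro conjI bdd_belowI2)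
qed (use \<Phi>0 in simp)

text \<open>The lower bound for \<open>\<Phi> n\<close> interpolates between a constant and \<open>V\<close>: splitting the running cost
  as \<open>\<rho>\<^sup>n c + (1 - \<rho>\<^sup>n) c\<close> with \<open>\<rho> = 1 - \<theta>\<close>, the first part is at least \<open>\<rho>\<^sup>n (\<theta> V - q)\<close>, and the second
  is handled by the optimality equation.\<close>

lemma value_iteration_lower_bound:
  assumes V: "V \<in> borel_measurable borel" "\<And>y. m \<le> V y"
      "\<And>x. attains_min (bellman M V x) (actions M x) (ereal (V x))"
    and \<Phi>: "\<And>n. \<Phi> n \<in> borel_measurable borel" "\<And>n. bdd_below (range (\<Phi> n))" "value_iteration M \<Phi>"
    and theta: "0 < \<theta>" "\<theta> < 1" and q: "0 \<le> q"
    and growth: "\<And>x u. (x, u) \<in> KK M \<Longrightarrow> cost M (x, u) < \<infinity> \<Longrightarrow> \<theta> * V x - q \<le> rcost (x, u)"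
    and init: "\<And>x. - p \<le> \<Phi> 0 x"
  shows "(1 - (1 - \<theta>) ^ n) * V x - (p + q * (1 - (1 - \<theta>) ^ n) / \<theta>) \<le> \<Phi> n x"
proof (induction n arbitrary: x)
  case 0
  then show ?case using init by simp
next
  case (Suc n)
  define \<alpha> where "\<alpha> = 1 - (1 - \<theta>) ^ n"
  define s where "s = p + q * \<alpha> / \<theta>"
  have alpha: "0 \<le> \<alpha>" "\<alpha> \<le> 1" using theta by (auto simp: \<alpha>_def power_le_one)
  have IH: "\<alpha> * V y - s \<le> \<Phi> n y" for y
    using Suc[of y] by (simp add: \<alpha>_def s_def)
  obtain m' where m': "\<And>y. m' \<le> \<Phi> n y" using \<Phi>(2)[of n] by (auto simp: bdd_below_def)
  have "attains_min (bellman M (\<Phi> n) x) (actions M x) (ereal (\<Phi> (Suc n) x))"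
    using \<Phi>(3) by (simp add: value_iteration_def)
  then obtain u where u: "(x, u) \<in> KK M" "bellman M (\<Phi> n) x u = ereal (\<Phi> (Suc n) x)"
    by (rule attains_minD)
  have fin: "cost M (x, u) < \<infinity>" "integrable (kernel M (x, u)) (\<Phi> n)"
    using bellman_finite[OF u(1) \<Phi>(1) m'] u(2) by auto
  interpret prob_space "kernel M (x, u)" by (rule kernel_prob[OF u(1)])
  have \<Phi>_Suc: "\<Phi> (Suc n) x = rcost (x, u) + (\<integral>y. \<Phi> n y \<partial>kernel M (x, u))"
    using u(2) bellman_eq[OF fin] by simp
  have "\<alpha> * (V x - rcost (x, u)) - s \<le> (\<integral>y. \<Phi> n y \<partial>kernel M (x, u))"
  \<comment> \<open>The action \<open>u\<close> minimizes for \<open>\<Phi> n\<close>, not for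
    \<open>V\<close>, so integrability of \<open>V\<close> has to come from domination by
    \<open>\<Phi> n\<close> in the induction hypothesis. That needs a positive \<alpha>; when
    \<alpha> = 0, \<open>V\<close> drops out.\<close>
  proof (cases "\<alpha> = 0")
    case True
    then have "- s \<le> \<Phi> n y" for y using IH[of y] by simp
    then have "- s \<le> (\<integral>y. \<Phi> n y \<partial>kernel M (x, u))"
      by (intro integral_ge_const[OF fin(2)]) simp
    with True show ?thesis by simp
  next
    case False
    have V_int: "integrable (kernel M (x, u)) V"
    proof (rule Bochner_Integration.integrable_bound)
      show "integrable (kernel M (x, u)) (\<lambda>y. \<bar>(\<Phi> n y + s) / \<alpha>\<bar> + \<bar>m\<bar>)"
        using fin(2) by simp
      show "V \<in> borel_measurable (kernel M (x, u))"
        using V(1) by (simp add: measurable_cong_sets[OF kernel_sets[OF u(1)] refl])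
      have "V y \<le> (\<Phi> n y + s) / \<alpha>" for y
        using IH[of y] False alpha(1) by (subst pos_le_divide_eq) (simp_all add: mult.commute)
      then have "norm (V y) \<le> norm (\<bar>(\<Phi> n y + s) / \<alpha>\<bar> + \<bar>m\<bar>)" for y
        using V(2)[of y] abs_ge_self[of "(\<Phi> n y + s) / \<alpha>"] abs_ge_minus_self[of m]
        unfolding real_norm_def by (smt (verit, ccfv_threshold) order_trans)
      then show "AE y in kernel M (x, u). norm (V y) \<le> norm (\<bar>(\<Phi> n y + s) / \<alpha>\<bar> + \<bar>m\<bar>)"
        by simp
    qed
    have "ereal (V x) \<le> bellman M V x u"
      by (rule attains_min_le[OF V(3) u(1)])
    then have "V x - rcost (x, u) \<le> (\<integral>y. V y \<partial>kernel M (x, u))"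
      by (simp add: bellman_eq[OF fin(1) V_int])
    then have "\<alpha> * (V x - rcost (x, u)) - s \<le> \<alpha> * (\<integral>y. V y \<partial>kernel M (x, u)) - s"
      using alpha by (simp add: mult_left_mono)
    also have "\<dots> = (\<integral>y. \<alpha> * V y - s \<partial>kernel M (x, u))"
      using V_int prob_space by simp
    also have "\<dots> \<le> (\<integral>y. \<Phi> n y \<partial>kernel M (x, u))"
      using IH V_int fin(2) by (intro integral_mono) auto
    finally show ?thesis .
  qed
  moreover have "(1 - \<alpha>) * (\<theta> * V x - q) \<le> (1 - \<alpha>) * rcost (x, u)"
    using alpha growth[OF u(1) fin(1)] by (intro mult_left_mono) auto
  ultimately have "(1 - \<alpha>) * (\<theta> * V x - q) + \<alpha> * V x - s \<le> \<Phi> (Suc n) x"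
    by (simp add: \<Phi>_Suc algebra_simps)
  moreover have "(1 - \<alpha>) * (\<theta> * V x - q) + \<alpha> * V x - s =
      (1 - (1 - \<theta>) ^ Suc n) * V x - (p + q * (1 - (1 - \<theta>) ^ Suc n) / \<theta>)"
  proof -
    define t where "t = (1 - \<theta>) ^ n"
    \<comment> \<open>The constants add up to the geometric sum of q (1 - \<theta>)^i over i \<le>
      n.\<close>
    have "q * (1 - (1 - \<theta>) * t) / \<theta> = q * (1 - t) / \<theta> + q * t"
      using theta by (simp add: field_simps)
    then show ?thesis
      unfolding \<alpha>_def s_def power_Suc t_def[symmetric] by (simp add: algebra_simps)
  qed
  ultimately show ?case by linarith
qed

section \<open>Kernel induced by a measurable selector\<close>

lemma selector_kernel_measurable:
  assumes s: "measurable_selector M s"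
  shows "(\<lambda>x. kernel M (x, s x)) \<in> borel \<rightarrow>\<^sub>M prob_algebra borel"
proof -
  have [measurable]: "s \<in> borel_measurable borel" and "\<And>x. (x, s x) \<in> KK M"
    using s by (auto simp: measurable_selector_def KK_iff)
  then have "(\<lambda>x. (x, s x)) \<in> borel \<rightarrow>\<^sub>M restrict_space borel (KK M)"
    by (intro measurable_restrict_space2 borel_measurable_Pair) auto
  moreover have "kernel M \<in> restrict_space borel (KK M) \<rightarrow>\<^sub>M prob_algebra borel"
    using mdp by (simp add: is_mdp_def)
  ultimately show ?thesis
    by (rule measurable_compose)
qed

text \<open>The bind with a Dirac mass requires measurability in the action on the whole space,
  which is checked separately on the available actions and on the rest, where
  \<open>kernel_ext\<close> is constant.\<close>

lemma kernel_under_selector: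
  assumes s: "measurable_selector M s"
  shows "kernel_under M (dirac_strategy s) x = kernel M (x, s x)"
proof -
  have A: "actions M x \<in> sets borel" and K: "kernel M \<in> restrict_space borel (KK M) \<rightarrow>\<^sub>M prob_algebra borel"
    using mdp by (auto simp: is_mdp_def)
  have "(\<lambda>u. kernel_ext M (x, u)) = (\<lambda>u. if u \<in> actions M x then kernel M (x, u) else return borel x)"
    by (auto simp: kernel_ext_def KK_iff)
  moreover have "(\<lambda>u. if u \<in> actions M x then kernel M (x, u) else return borel x) \<in> borel \<rightarrow>\<^sub>M prob_algebra borel"
  proof (subst measurable_If_restrict_space_iff)
    have "(\<lambda>u. (x, u)) \<in> restrict_space borel (actions M x) \<rightarrow>\<^sub>M restrict_space borel (KK M)"
      by (intro measurable_restrict_space2 measurable_restrict_space1 borel_measurable_Pair)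
         (auto simp: space_restrict_space KK_iff)
    from measurable_compose[OF this K]
    show "(\<lambda>u. kernel M (x, u)) \<in> restrict_space borel {u. u \<in> actions M x} \<rightarrow>\<^sub>M prob_algebra borel \<and>
        (\<lambda>u. return borel x) \<in> restrict_space borel {u. u \<notin> actions M x} \<rightarrow>\<^sub>M prob_algebra borel"
      by (auto intro!: measurable_const simp: space_prob_algebra prob_space_return)
  qed (use A in simp)
  ultimately have "(\<lambda>u. kernel_ext M (x, u)) \<in> borel \<rightarrow>\<^sub>M subprob_algebra borel"
    by (simp add: measurable_prob_algebraD)
  then have "kernel_under M (dirac_strategy s) x = kernel_ext M (x, s x)"
    unfolding kernel_under_def dirac_strategy_def by (subst bind_return) auto
  then show ?thesis
    using s by (simp add: kernel_ext_def measurable_selector_def KK_iff)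
qed

end

section \<open>Usable forms of the hypotheses\<close>

lemma A1_imp_K_inf_compact:
  assumes "A1 M TA TB"
  shows "K_inf_compact M"
  using assms unfolding A1_def
proof
  assume "(\<exists>x. optimal_cost M (return borel x) < \<infinity>) \<and> inf_compact M"
  then have *: "compact {z \<in> KK M. cost M z \<le> ennreal \<kappa>}" for \<kappa> :: real
    by (simp add: inf_compact_def)
  show ?thesis
    unfolding K_inf_compact_def
  proof safe
    fix K :: "'a set" and \<kappa> :: real
    assume "compact K"
    \<comment> \<open>Over a compact set of states the sublevel set is a closed strip intersected
      with a compact sublevel set.\<close>
    then have "closed (K \<times> (UNIV :: 'b set))"
      by (intro closed_Times closed_UNIV compact_imp_closed)
    from closed_Int_compact[OF this *[of \<kappa>]]
    show "compact {z \<in> K \<times> UNIV \<inter> KK M. cost M z \<le> ennreal \<kappa>}"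
      by (rule back_subst[of compact]) auto
  qed
qed simp

lemma lsc_bounded_belowD:
  assumes "f \<in> lsc_bounded_below"
  shows "f \<in> borel_measurable borel" "bdd_below (range f)"
proof -
  show "bdd_below (range f)" using assms by (simp add: lsc_bounded_below_def)
  have "open {z. a < f z}" for a
    using assms by (simp add: lsc_bounded_below_def lsc_on_def)
  then show "f \<in> borel_measurable borel"
    by (intro borel_measurable_iff_greater[THEN iffD2]) simp
qed

lemma O_classD:
  assumes "g \<in> O_class f"
  obtains c where "0 \<le> c" "\<And>x. \<bar>g x\<bar> \<le> c * (1 + \<bar>f x\<bar>)"
proof -
  have "weighted_norm f g \<noteq> \<infinity>" using assms by (auto simp: O_class_def)
  then obtain n where n: "weighted_norm f g < ereal (real n)"
    using less_PInf_Ex_of_nat by blast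
  have "\<bar>g x\<bar> \<le> real n * (1 + \<bar>f x\<bar>)" for x
  proof -
    have "ereal (\<bar>g x\<bar> / (1 + \<bar>f x\<bar>)) \<le> weighted_norm f g"
      unfolding weighted_norm_def by (rule SUP_upper) simp
    with n have "ereal (\<bar>g x\<bar> / (1 + \<bar>f x\<bar>)) < ereal (real n)" by (rule le_less_trans[rotated])
    then have "\<bar>g x\<bar> / (1 + \<bar>f x\<bar>) \<le> real n" by simp
    moreover have "0 < 1 + \<bar>f x\<bar>" by simp
    ultimately show ?thesis by (simp add: pos_divide_le_eq)
  qed
  then show thesis by (intro that[of "real n"]) simp_all
qed

section \<open>Comparison of \<open>\<Phi> n\<close> with \<open>V\<close> under the optimal
  kernel\<close>

theorem theorem6p1:
  fixes M :: "('x::polish_space, 'u::polish_space) mdp"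
    and B :: "'x set" and \<nu> :: "'x measure" and \<delta> :: real
    and V :: "'x \<Rightarrow> real" and v_star :: "'x \<Rightarrow> 'u" and \<pi>_star :: "'x measure"
    and \<theta>\<^sub>1 \<theta>\<^sub>2 :: real and \<Phi> :: "nat \<Rightarrow> 'x \<Rightarrow> real"
  assumes "is_mdp M" and "basic_assumption M"
    and "A0 M B \<nu> \<delta>"
    and "A1 M TYPE('a::polish_space) TYPE('b::polish_space)"
    and "A2 M B \<nu> \<delta>"
    and "is_Vstar M B \<nu> \<delta> V"
    and "measurable_selector M v_star"
    and "\<forall>x. is_arg_min (bellman M V x) (\<lambda>u. u \<in> actions M x) (v_star x)"
    and "optimal M (as_strategy (dirac_strategy v_star))"
    and "invariant_prob M (dirac_strategy v_star) \<pi>_star"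
    and "H2 M V \<theta>\<^sub>1 \<theta>\<^sub>2"
    and "\<Phi> 0 \<in> lsc_bounded_below \<inter> O_class V"
    and "value_iteration M \<Phi>"
  shows "(\<exists>C. \<forall>x n. \<bar>\<Phi> n x - V x\<bar> \<le> C * (1 + (1 - \<theta>\<^sub>1) ^ n * \<bar>V x\<bar>)) \<and>
         (\<exists>a. AE x in \<pi>_star. (\<lambda>n. \<Phi> n x - V x) \<longlonglongrightarrow> a)"
proof -
  have beta_less: "beta M < (INF z \<in> ((- B) \<times> UNIV) \<inter> KK M. cost M z)"
    using \<open>A0 M B \<nu> \<delta>\<close> by (simp add: A0_def)
  have "beta M < \<infinity>"
    using less_le_trans[OF beta_less top_greatest] by simp
  then interpret continuous_mdp M
    by unfold_locales (use assms(1,2) in auto)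
  define P where "P x = kernel M (x, v_star x)" for x
  define r where "r x = rcost (x, v_star x)" for x
  define b where "b = enn2real (beta M)"
  have v_KK: "(x, v_star x) \<in> KK M" for x
    using assms(7) by (simp add: measurable_selector_def KK_iff)

  have V: "V \<in> borel_measurable borel" "bdd_below (range V)"
    and V_min: "\<And>x. attains_min (bellman M V x) (actions M x) (ereal (V x))"
    using assms(6) lsc_bounded_belowD by (auto simp: is_Vstar_def)
  then obtain m where m: "\<And>x. m \<le> V x" by (auto simp: bdd_below_def)
  have V_bellman: "bellman M V x (v_star x) = ereal (V x)" for x
  proof (rule antisym)
    obtain u where "(x, u) \<in> KK M" "bellman M V x u = ereal (V x)"
      using V_min by (rule attains_minD)
    then show "bellman M V x (v_star x) \<le> ereal (V x)"
      using assms(8) unfolding is_arg_min_def KK_iff by (metis not_less)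
    show "ereal (V x) \<le> bellman M V x (v_star x)"
      by (rule attains_min_le[OF V_min v_KK])
  qed
  have fin: "cost M (x, v_star x) < \<infinity>" and V_int: "integrable (P x) V" for x
    using bellman_finite[OF v_KK V(1) m] by (auto simp: V_bellman P_def)
  have V_eq: "V x = r x + (\<integral>y. V y \<partial>P x)" for x
    using bellman_eq[OF fin[of x] V_int[of x, unfolded P_def]] V_bellman[of x]
    by (metis P_def ereal.inject r_def)

  have theta: "0 < \<theta>\<^sub>1" "\<theta>\<^sub>1 < 1"
    using assms(11) by (auto simp: H2_def)
  \<comment> \<open>H2 bounds the cost, whereas \<open>rcost\<close> is the cost minus
    \<open>b\<close>; the maximum only makes \<open>q\<close> nonnegative.\<close>
  define q where "q = max 0 (\<theta>\<^sub>2 + b)"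
  have q: "0 \<le> q" by (simp add: q_def)
  have growth: "\<theta>\<^sub>1 * V x - q \<le> rcost (x, u)" if u: "(x, u) \<in> KK M" "cost M (x, u) < \<infinity>" for x u
  proof -
    have "ereal (\<theta>\<^sub>1 * V x - \<theta>\<^sub>2) \<le> enn2ereal (cost M (x, u))"
      using assms(11) u(1) by (auto simp: H2_def KK_iff intro: order_trans INF_lower)
    also have "\<dots> = ereal (enn2real (cost M (x, u)))"
      using cost_real[OF u(2)] by (metis enn2ereal_ennreal enn2real_nonneg)
    finally show ?thesis by (simp add: rcost_def q_def b_def)
  qed
  obtain \<epsilon> where eps: "0 < \<epsilon>" "\<And>x. x \<notin> B \<Longrightarrow> \<epsilon> \<le> r x"
  proof -
    \<comment> \<open>A finite value strictly between gives a real gap even if the infimum of the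
      cost off \<open>B\<close> is infinite.\<close>
    obtain c where c: "beta M < c" "c < (INF z \<in> ((- B) \<times> UNIV) \<inter> KK M. cost M z)"
      using dense[OF beta_less] by blast
    then obtain c' where c': "c = ennreal c'" "0 \<le> c'"
      by (metis ennreal_cases not_less_iff_gr_or_eq top.not_eq_extremum)
    have beta: "beta M = ennreal b"
      using beta_finite by (simp add: b_def less_top)
    have "0 \<le> b" by (simp add: b_def)
    then have "b < c'" using c(1) by (simp add: beta c' ennreal_less_iff)
    moreover have "c' - b \<le> r x" if "x \<notin> B" for x
    proof -
      have "ennreal c' \<le> cost M (x, v_star x)"
        using c(2) that v_KK[of x] c'(1)
        by (intro order_trans[OF less_imp_le[OF c(2), unfolded c'(1)] INF_lower]) auto
      then have "c' \<le> enn2real (cost M (x, v_star x))"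
        using cost_real[OF fin[of x]] by (metis ennreal_le_iff enn2real_nonneg)
      then show ?thesis by (simp add: r_def rcost_def b_def)
    qed
    ultimately show thesis by (intro that[of "c' - b"]) auto
  qed

  define k where "k = 1 - m"
  define W where "W x = V x + k" for x
  have W: "1 \<le> W x" for x using m[of x] by (simp add: W_def k_def)
  have P: "P \<in> borel \<rightarrow>\<^sub>M prob_algebra borel"
    unfolding P_def by (rule selector_kernel_measurable[OF assms(7)])
  have P_prob: "prob_space (P x)" for x
    unfolding P_def by (rule kernel_prob[OF v_KK])
  have W_int: "integrable (P x) W" for x
  proof -
    interpret prob_space "P x" by (rule P_prob)
    show ?thesis unfolding W_def using V_int by simp
  qed
  have PW: "(\<integral>y. W y \<partial>P x) = W x - r x" for x
  proof -
    interpret prob_space "P x" by (rule P_prob)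
    have "(\<integral>y. W y \<partial>P x) = (\<integral>y. V y \<partial>P x) + k"
      unfolding W_def using V_int prob_space by simp
    then show ?thesis using V_eq[of x] by (simp add: W_def)
  qed
  define K where "K = max 1 (\<theta>\<^sub>1 * k + q)"
  have K: "0 < K" by (simp add: K_def)
  have PW_le: "(\<integral>y. W y \<partial>P x) \<le> (1 - \<theta>\<^sub>1) * W x + K" for x
  proof -
    have "\<theta>\<^sub>1 * V x - q \<le> r x" unfolding r_def by (rule growth[OF v_KK fin])
    moreover have "(1 - \<theta>\<^sub>1) * W x = W x - \<theta>\<^sub>1 * V x - \<theta>\<^sub>1 * k"
      by (simp add: W_def algebra_simps)
    moreover have "\<theta>\<^sub>1 * k + q \<le> K" by (simp add: K_def)
    ultimately show ?thesis using PW[of x] by linarith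
  qed
  \<comment> \<open>Off \<open>B\<close>, if \<open>W x\<close> is at least \<open>R\<close>, half
    of the decay rate \<open>\<theta>\<^sub>1\<close> absorbs \<open>K\<close>; if it is at most
    \<open>R\<close>, the decrease by \<epsilon> is at least
    \<open>\<epsilon> / R * W x\<close>.\<close>
  define R where "R = 2 * K / \<theta>\<^sub>1"
  define \<rho> where "\<rho> = max (1 - \<theta>\<^sub>1 / 2) (1 - \<epsilon> / R)"
  have R: "0 < R" using K theta by (simp add: R_def)
  have rho: "0 < \<rho>" "\<rho> < 1" using theta eps(1) R by (auto simp: \<rho>_def)
  have drift: "(\<integral>y. W y \<partial>P x) \<le> \<rho> * W x + K * indicator B x" for x
  proof -
    have W0: "0 \<le> W x" using W[of x] by simp
    have 1: "(1 - \<theta>\<^sub>1 / 2) * W x \<le> \<rho> * W x" and 2: "(1 - \<epsilon> / R) * W x \<le> \<rho> * W x"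
      using W0 by (auto simp: \<rho>_def intro!: mult_right_mono)
    consider "x \<in> B" | "x \<notin> B" "R \<le> W x" | "x \<notin> B" "W x \<le> R" by linarith
    then show ?thesis
    proof cases
      case 1
      have "(1 - \<theta>\<^sub>1) * W x \<le> (1 - \<theta>\<^sub>1 / 2) * W x"
        using W0 theta by (intro mult_right_mono) auto
      with PW_le[of x] \<open>(1 - \<theta>\<^sub>1 / 2) * W x \<le> \<rho> * W x\<close> 1 show ?thesis by simp
    next
      case 2
      then have "K \<le> \<theta>\<^sub>1 / 2 * W x"
        using theta by (simp add: R_def field_simps)
      moreover have "(1 - \<theta>\<^sub>1) * W x + \<theta>\<^sub>1 / 2 * W x = (1 - \<theta>\<^sub>1 / 2) * W x"
        by (simp add: field_simps)
      ultimately show ?thesis using PW_le[of x] 1 2(1) by simp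
    next
      case 3
      have "\<epsilon> * W x \<le> \<epsilon> * R" using 3 eps(1) by simp
      then have "\<epsilon> / R * W x \<le> \<epsilon>" using R by (simp add: field_simps)
      with eps(2)[OF 3(1)] 2 3(1) show ?thesis by (simp add: PW left_diff_distrib)
    qed
  qed
  have A0: "B \<in> sets borel" "\<nu> \<in> space (prob_algebra borel)" "emeasure \<nu> B = 1" "0 < \<delta>"
    using assms(3) unfolding A0_def by blast+
  have pi: "\<pi>_star \<in> space (prob_algebra borel)"
    using assms(10) by (simp only: invariant_prob_def)
  have minor: "ennreal \<delta> * emeasure \<nu> A \<le> emeasure (P x) A" if "x \<in> B" "A \<in> sets borel" for x A
  proof -
    have "\<forall>A \<in> sets borel. \<forall>(x, u) \<in> KK M.
        ennreal \<delta> * emeasure \<nu> A * indicator B x \<le> emeasure (kernel M (x, u)) A"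
      using assms(3) unfolding A0_def by blast
    then have "ennreal \<delta> * emeasure \<nu> A * indicator B x \<le> emeasure (P x) A"
      unfolding P_def using that(2) v_KK[of x] by blast
    then show ?thesis using that(1) by simp
  qed
  have inv: "\<pi>_star \<bind> P = \<pi>_star"
  proof -
    have "kernel_under M (dirac_strategy v_star) = P"
      by (rule ext) (simp only: kernel_under_selector[OF assms(7)] P_def)
    then show ?thesis using assms(10) by (simp only: invariant_prob_def)
  qed
  have W_meas: "W \<in> borel_measurable borel"
    unfolding W_def using V(1) by simp
  interpret invariant_harris_kernel P W B \<rho> K \<nu> \<delta> \<pi>_star
  proof unfold_locales
    show "P \<in> borel \<rightarrow>\<^sub>M prob_algebra borel" by (rule P)
    show "W \<in> borel_measurable borel" by (rule W_meas)
    show "1 \<le> W x" for x by (rule W)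
    show "integrable (P x) W" for x by (rule W_int)
    show "(\<integral>y. W y \<partial>P z) \<le> \<rho> * W z + K * indicator B z" for z by (rule drift)
    show "0 < \<rho>" "\<rho> < 1" by (rule rho)+
    show "0 < K" by (rule K)
    show "B \<in> sets borel" "\<nu> \<in> space (prob_algebra borel)" "emeasure \<nu> B = 1" "0 < \<delta>" by (rule A0)+
    show "ennreal \<delta> * emeasure \<nu> A \<le> emeasure (P x) A" if "x \<in> B" "A \<in> sets borel" for x A
      using that by (rule minor)
    show "\<pi>_star \<in> space (prob_algebra borel)" by (rule pi)
    show "\<pi>_star \<bind> P = \<pi>_star" by (rule inv)
  qed

  have \<Phi>: "\<Phi> n \<in> borel_measurable borel" "bdd_below (range (\<Phi> n))" for n
    using value_iteration_regular[OF A1_imp_K_inf_compact[OF assms(4)]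
        lsc_bounded_belowD[OF IntD1[OF assms(12)]] assms(13), of n]
    by (rule conjunct1, rule conjunct2)
  obtain p' where p': "\<And>x. p' \<le> \<Phi> 0 x" using \<Phi>(2)[of 0] by (auto simp: bdd_below_def)
  define p where "p = \<bar>p'\<bar>"
  have p: "- p \<le> \<Phi> 0 x" for x using p'[of x] unfolding p_def by linarith
  obtain c where c: "0 \<le> c" "\<And>x. \<bar>\<Phi> 0 x\<bar> \<le> c * (1 + \<bar>V x\<bar>)"
    using O_classD[OF IntD2[OF assms(12)]] by blast
  define t where "t n = (1 - \<theta>\<^sub>1) ^ n" for n
  have t: "0 \<le> t n" "t n \<le> 1" for n using theta by (auto simp: t_def power_le_one)
  define f where "f n x = \<Phi> n x - V x" for n x
  have V_abs: "\<bar>V x\<bar> \<le> (1 + \<bar>k\<bar>) * W x" for x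
  proof -
    have "\<bar>V x\<bar> \<le> W x + \<bar>k\<bar>" using W[of x] unfolding W_def by linarith
    moreover have "\<bar>k\<bar> * 1 \<le> \<bar>k\<bar> * W x" by (rule mult_left_mono[OF W abs_ge_zero])
    ultimately show ?thesis unfolding distrib_right by linarith
  qed

  have lower: "- (t n * V x) - (p + q / \<theta>\<^sub>1) \<le> f n x" for n x
  proof -
    have "(1 - t n) * V x - (p + q * (1 - t n) / \<theta>\<^sub>1) \<le> \<Phi> n x"
      unfolding t_def
      by (rule value_iteration_lower_bound[OF V(1) m V_min \<Phi> assms(13) theta q growth p])
    moreover have "q * (1 - t n) / \<theta>\<^sub>1 \<le> q / \<theta>\<^sub>1"
      using t theta by (intro divide_right_mono mult_left_le) (auto simp: q_def)
    ultimately show ?thesis by (simp add: f_def left_diff_distrib)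
  qed
  \<comment> \<open>Chosen from the growth of \<open>\<Phi> 0\<close> and \<open>V_abs\<close> to
    start the induction; \<open>D\<close> solves
    \<open>C\<^sub>1 * K = D * \<theta>\<^sub>1\<close>, which closes its recursion.\<close>
  define C\<^sub>1 where "C\<^sub>1 = c + (c + 1) * (1 + \<bar>k\<bar>)"
  have C1: "0 \<le> C\<^sub>1" using c(1) by (simp add: C\<^sub>1_def)
  define D where "D = C\<^sub>1 * K / \<theta>\<^sub>1"
  have D: "0 \<le> D" using C1 K theta by (simp add: D_def)
  \<comment> \<open>Conditional on the upper bound at \<open>n\<close>, since the induction for
    \<open>upper\<close> needs it to apply \<open>T\<close>. The radius is independent of
    \<open>n\<close>, as the convergence theorem requires.\<close>
  have f_wbdd: "wbdd (C\<^sub>1 + D + (1 + \<bar>k\<bar>) + (p + q / \<theta>\<^sub>1)) (f n)"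
    if up: "\<And>x. f n x \<le> C\<^sub>1 * t n * W x + D * (1 - t n)" for n
    unfolding wbdd_def
  proof safe
    show "f n \<in> borel_measurable borel" unfolding f_def using V(1) \<Phi>(1) by simp
    fix x
    have pq: "0 \<le> p + q / \<theta>\<^sub>1" using theta by (simp add: p_def q_def)
    have "C\<^sub>1 * t n * W x \<le> C\<^sub>1 * 1 * W x"
      using C1 t W[of x] by (intro mult_right_mono mult_left_mono) auto
    moreover have "D * (1 - t n) \<le> D * W x"
      using D t[of n] W[of x] by (intro mult_left_mono) auto
    moreover have "t n * V x \<le> 1 * \<bar>V x\<bar>"
      by (rule order_trans[OF mult_left_mono[OF abs_ge_self t(1)] mult_right_mono[OF t(2) abs_ge_zero]])
    moreover have "p + q / \<theta>\<^sub>1 \<le> (p + q / \<theta>\<^sub>1) * W x"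
      using mult_left_mono[OF W pq] by simp
    moreover have "0 \<le> C\<^sub>1 * W x" "0 \<le> D * W x" "0 \<le> (1 + \<bar>k\<bar>) * W x"
      using C1 D W[of x] by auto
    ultimately show "\<bar>f n x\<bar> \<le> (C\<^sub>1 + D + (1 + \<bar>k\<bar>) + (p + q / \<theta>\<^sub>1)) * W x"
      using up[of x] lower[of n x] V_abs[of x] pq unfolding distrib_right by linarith
  qed
  \<comment> \<open>The action of \<open>v_star\<close> is merely available for
    \<open>\<Phi> n\<close> but attains equality for \<open>V\<close>; subtracting the two relations
    cancels the cost.\<close>
  have f_sub: "f (Suc n) x \<le> T (f n) x" if f: "wbdd a (f n)" for a n x
  proof -
    have \<Phi>_int: "integrable (P x) (\<Phi> n)"
      using Bochner_Integration.integrable_add[OF wbdd_integrable[OF f] V_int] by (simp add: f_def)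
    have "attains_min (bellman M (\<Phi> n) x) (actions M x) (ereal (\<Phi> (Suc n) x))"
      using assms(13) by (simp add: value_iteration_def)
    then have "ereal (\<Phi> (Suc n) x) \<le> bellman M (\<Phi> n) x (v_star x)"
      by (rule attains_min_le[OF _ v_KK])
    then have "\<Phi> (Suc n) x \<le> r x + (\<integral>y. \<Phi> n y \<partial>P x)"
      using bellman_eq[OF fin[of x] \<Phi>_int[unfolded P_def]] by (simp add: r_def P_def)
    then show ?thesis
      using V_eq[of x] \<Phi>_int V_int by (simp add: T_def f_def)
  qed
  have upper: "f n x \<le> C\<^sub>1 * t n * W x + D * (1 - t n)" for n x
  proof (induction n arbitrary: x)
    case 0
    have "f 0 x \<le> c + (c + 1) * \<bar>V x\<bar>"
      using c(2)[of x] by (simp add: f_def algebra_simps)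
    also have "\<dots> \<le> c * W x + (c + 1) * ((1 + \<bar>k\<bar>) * W x)"
      using c(1) V_abs[of x] mult_left_mono[OF W c(1)] by (intro add_mono mult_left_mono) auto
    finally show ?case by (simp add: t_def C\<^sub>1_def algebra_simps)
  next
    case (Suc n)
    note f = f_wbdd[OF Suc]
    have "f (Suc n) x \<le> T (f n) x" by (rule f_sub[OF f])
    also have "\<dots> \<le> T (\<lambda>x. C\<^sub>1 * t n * W x + D * (1 - t n)) x"
      by (rule T_mono[OF f wbdd_add[OF wbdd_cmult[OF wbdd_weight] wbdd_const] Suc])
    also have "\<dots> = C\<^sub>1 * t n * T W x + D * (1 - t n)"
      by (subst T_add[OF wbdd_cmult[OF wbdd_weight] wbdd_const]) (simp add: T_cmult T_const)
    also have "\<dots> \<le> C\<^sub>1 * t n * ((1 - \<theta>\<^sub>1) * W x + K) + D * (1 - t n)"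
      using C1 t PW_le[of x] by (intro add_right_mono mult_left_mono) (auto simp: T_def)
    also have "\<dots> = C\<^sub>1 * t (Suc n) * W x + D * (1 - t (Suc n))"
    proof -
      have "C\<^sub>1 * K = D * \<theta>\<^sub>1" using theta by (simp add: D_def)
      then have "C\<^sub>1 * t n * K = D * \<theta>\<^sub>1 * t n" by (simp add: mult_ac)
      then show ?thesis by (simp add: t_def algebra_simps)
    qed
    finally show ?case .
  qed

  \<comment> \<open>\<open>V\<close> may take negative values, hence the absolute value. Replacing
    \<open>W\<close> by \<open>V\<close> costs at most \<open>C\<^sub>1 * \<bar>k\<bar>\<close>,
    because \<open>t n \<le> 1\<close>.\<close>
  have "\<bar>f n x\<bar> \<le> (1 + C\<^sub>1 + C\<^sub>1 * \<bar>k\<bar> + D + (p + q / \<theta>\<^sub>1)) * (1 + t n * \<bar>V x\<bar>)" for n x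
  proof -
    define y where "y = t n * \<bar>V x\<bar>"
    define e where "e = C\<^sub>1 * \<bar>k\<bar> + D + (p + q / \<theta>\<^sub>1)"
    have "t n * W x \<le> y + \<bar>k\<bar>"
    proof -
      have "t n * W x \<le> t n * (\<bar>V x\<bar> + \<bar>k\<bar>)"
        using t by (intro mult_left_mono) (auto simp: W_def)
      also have "\<dots> \<le> t n * \<bar>V x\<bar> + 1 * \<bar>k\<bar>"
        unfolding distrib_left using t by (intro add_left_mono mult_right_mono) auto
      finally show ?thesis by (simp add: y_def)
    qed
    then have "C\<^sub>1 * t n * W x \<le> C\<^sub>1 * y + C\<^sub>1 * \<bar>k\<bar>"
      using mult_left_mono[OF _ C1, of "t n * W x" "y + \<bar>k\<bar>"] by (simp add: algebra_simps)
    moreover have "D * (1 - t n) \<le> D" using D t[of n] by (simp add: mult_left_le)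
    moreover have "t n * V x \<le> y" unfolding y_def using t by (simp add: mult_left_mono)
    moreover have y: "0 \<le> y" using t by (simp add: y_def)
    moreover have e: "0 \<le> C\<^sub>1 * \<bar>k\<bar>" "0 \<le> p + q / \<theta>\<^sub>1"
      using C1 theta by (auto simp: p_def q_def)
    moreover have "0 \<le> e * y" "0 \<le> C\<^sub>1 * y"
      using e y C1 D by (auto simp: e_def)
    ultimately have "\<bar>f n x\<bar> \<le> 1 + C\<^sub>1 + e + y + C\<^sub>1 * y + e * y"
      using upper[of n x] lower[of n x] C1 D e_def by linarith
    then show ?thesis by (simp add: e_def y_def algebra_simps)
  qed
  then have "\<exists>C. \<forall>x n. \<bar>\<Phi> n x - V x\<bar> \<le> C * (1 + (1 - \<theta>\<^sub>1) ^ n * \<bar>V x\<bar>)"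
    unfolding f_def t_def by blast
  moreover have "\<exists>a. AE x in \<pi>_star. (\<lambda>n. f n x) \<longlonglongrightarrow> a"
    using f_wbdd[OF upper] f_sub[OF f_wbdd[OF upper]] by (rule subsolution_convergence)
  ultimately show ?thesis by (simp add: f_def)
qed

end
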